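(* Let $\lambda\in(0,\infty)$, let $\lambda':=\lambda/(4\sqrt2)$, and let $(n_j)_{j\ge1}$ be a sequence of positive even integers and $(d_j)_{j\ge1}$ a sequence of positive integers with $n_j\to\infty$ and $n_j2^{-d_j}\to\lambda$ as $j\to\infty$. Let $f_{n_j,d_j}$ be uniformly chosen from $\mathrm{Hom}(T_{n_j,d_j},0)$. Then $$|\mathrm{Rng}(f_{n_j,d_j})|\xrightarrow[j\to\infty]{(d)}\big|\mathrm{Rng}\big(B^{2N(\lambda')}\big)\big|+2,$$ where $\xrightarrow{(d)}$ denotes convergence in distribution.
   Context: For $n\ge1$ even and $d\ge1$, $T_{n,d}$ is the graph with vertex set $\{0,1,\dots,n-1\}$ in which $i,j$ are adjacent iff $\min\{|i-j|,n-|i-j|\}\in\{1,3,\dots,2d+1\}$. $\mathrm{Hom}(T_{n,d},0)$ is the finite set of functions $f\colon\{0,\dots,n-1\}\to\mathbb{Z}$ with $f(0)=0$ and $|f(i)-f(j)|=1$ whenever $i,j$ are adjacent in $T_{n,d}$. $\mathrm{Rng}(f)$ denotes the set of values taken by $f$. $\nu(\lambda')$ is the distribution of $X$ conditioned on $X=Y$, where $X,Y$ are independent Poisson($\lambda'$) variables; that is, $\nu(\lambda')(k)$ is proportional to $(\lambda')^{2k}/(k!)^2$, $k\ge0$. For an even integer $k\ge0$, $B^k=(B^k_i)_{0\le i\le k}$ is a simple random walk bridge of length $k$, i.e. a simple random walk on $\mathbb{Z}$ started at $0$ run for $k$ steps and conditioned on $B^k_k=0$ (so $B^0$ is the single value $0$),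 and $\mathrm{Rng}(B^k):=\{B^k_i : 0\le i\le k\}$. $N(\lambda')\sim\nu(\lambda')$ is independent of the bridges, so $B^{2N(\lambda')}$ is obtained by first sampling $N(\lambda')$ and then sampling a bridge of length $2N(\lambda')$. *)

theory Defs
  imports "HOL-Probability.Probability"
begin

definition T_adj :: "nat \<Rightarrow> nat \<Rightarrow> nat \<Rightarrow> nat \<Rightarrow> bool" where
  "T_adj n d i j \<longleftrightarrow> i < n \<and> j < n \<and>
     (\<exists>m\<le>d. min \<bar>int i - int j\<bar> (int n - \<bar>int i - int j\<bar>) = 2 * int m + 1)"

text \<open>Functions on the vertex set are extensional (\<open>undefined\<close> outside \<open>{0..<n}\<close>), so that each
  function \<open>{0,\<dots>,n-1} \<rightarrow> \<int>\<close> is represented exactly once and counting is correct.\<close>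

definition Hom_T :: "nat \<Rightarrow> nat \<Rightarrow> (nat \<Rightarrow> int) set" where
  "Hom_T n d = {f \<in> {0..<n} \<rightarrow>\<^sub>E UNIV. f 0 = 0 \<and> (\<forall>i j. T_adj n d i j \<longrightarrow> \<bar>f i - f j\<bar> = 1)}"

definition nu :: "real \<Rightarrow> nat pmf" where
  "nu l = map_pmf fst (cond_pmf (pair_pmf (poisson_pmf l) (poisson_pmf l)) {(x, y). x = y})"

text \<open>A walk of length \<open>k\<close> is a function on all of \<open>nat\<close>; it stays constant after time \<open>k\<close>.\<close>

definition simple_random_walk :: "nat \<Rightarrow> (nat \<Rightarrow> int) pmf" where
  "simple_random_walk k =
     map_pmf (\<lambda>s i. \<Sum>j<i. s j) (Pi_pmf {..<k} 0 (\<lambda>_. pmf_of_set {-1, 1}))"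

text \<open>Only meaningful for even \<open>k\<close>: otherwise the conditioning event is null.\<close>

definition bridge :: "nat \<Rightarrow> (nat \<Rightarrow> int) pmf" where
  "bridge k = cond_pmf (simple_random_walk k) {w. w k = 0}"

text \<open>The law of the number of values of \<open>B\<close> where \<open>B\<close> is a bridge of random length \<open>2 N\<close>
  and \<open>N\<close> has law \<open>nu l\<close>.\<close>

definition bridge_range_size :: "real \<Rightarrow> nat pmf" where
  "bridge_range_size l =
     bind_pmf (nu l) (\<lambda>N. map_pmf (\<lambda>B. card (B ` {0..2 * N})) (bridge (2 * N)))"

text \<open>The uniform distribution \<open>pmf_of_set\<close> and the conditional distribution \<open>cond_pmf\<close> are
  unspecified outside the finite nonempty, respectively non-null, case; the lemmas below rule this out.\<close>

lemma Hom_T_nonempty: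
  assumes "even n" "n > 0"
  shows "Hom_T n d \<noteq> {}"
proof -
  have "restrict (\<lambda>i. int (i mod 2)) {0..<n} \<in> Hom_T n d"
    unfolding Hom_T_def
  proof (intro CollectI conjI allI impI)
    fix i j assume a: "T_adj n d i j"
    then obtain m where m: "i < n" "j < n"
      "min \<bar>int i - int j\<bar> (int n - \<bar>int i - int j\<bar>) = 2 * int m + 1"
      unfolding T_adj_def by blast
    have "odd (min \<bar>int i - int j\<bar> (int n - \<bar>int i - int j\<bar>))" using m(3) by simp
    then have "odd (int i - int j)" using assms(1) by (auto simp: min_def split: if_splits)
    then have "odd i \<noteq> odd j" by auto
    then show "\<bar>restrict (\<lambda>i. int (i mod 2)) {0..<n} i - restrict (\<lambda>i. int (i mod 2)) {0..<n} j\<bar> = 1"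
      using m by (auto simp: odd_iff_mod_2_eq_one even_iff_mod_2_eq_zero)
  qed (use assms in auto)
  then show ?thesis by blast
qed

lemma finite_Hom_T: "finite (Hom_T n d)"
proof -
  have b: "\<bar>f i\<bar> \<le> int i" if f: "f \<in> Hom_T n d" and "i < n" for f i
    using that(2)
  proof (induction i)
    case 0
    then show ?case using f by (simp add: Hom_T_def)
  next
    case (Suc i)
    have "T_adj n d i (Suc i)"
      unfolding T_adj_def using Suc.prems by (auto intro!: exI[of _ 0] simp: min_def)
    then have "\<bar>f i - f (Suc i)\<bar> = 1" using f by (simp add: Hom_T_def)
    then show ?case using Suc by simp
  qed
  have "Hom_T n d \<subseteq> ({0..<n} \<rightarrow>\<^sub>E {- int n..int n})"
  proof
    fix f assume f: "f \<in> Hom_T n d"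
    have "f i \<in> {- int n..int n}" if "i \<in> {0..<n}" for i
      using b[OF f, of i] that by auto
    then show "f \<in> ({0..<n} \<rightarrow>\<^sub>E {- int n..int n})"
      using f unfolding Hom_T_def by (auto simp: PiE_iff)
  qed
  then show ?thesis by (rule finite_subset) (intro finite_PiE; simp)
qed

lemma set_pmf_nu_cond_nonempty:
  assumes "l > 0"
  shows "set_pmf (pair_pmf (poisson_pmf l) (poisson_pmf l)) \<inter> {(x, y). x = y} \<noteq> {}"
  using assms by (auto simp: set_pair_pmf)

lemma set_pmf_bridge_cond_nonempty:
  assumes "even k"
  shows "set_pmf (simple_random_walk k) \<inter> {w. w k = 0} \<noteq> {}"
proof -
  define s where "s = (\<lambda>i. if i < k then (- 1) ^ i else (0::int))"
  have "s \<in> set_pmf (Pi_pmf {..<k} 0 (\<lambda>_. pmf_of_set {-1, 1}))"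
    by (auto simp: set_Pi_pmf PiE_dflt_def s_def minus_one_power_iff)
  moreover have "(\<Sum>j<k. s j) = 0"
  proof -
    have e: "(\<Sum>j<2 * m. (- 1) ^ j) = (0::int)" for m :: nat
      by (induction m) auto
    have "(\<Sum>j<k. s j) = (\<Sum>j<k. (- 1) ^ j)" by (simp add: s_def)
    then show ?thesis using e assms by (auto elim!: evenE)
  qed
  ultimately show ?thesis unfolding simple_random_walk_def by auto
qed

end

theory Submission
  imports Defs
begin

text \<open>Extend a homomorphism to an \<open>n\<close>-periodic \<open>F\<close> on the integers. In every window of \<open>2d + 2\<close>
  consecutive vertices one parity class is constant, so positions \<open>v\<close> with \<open>F (v + 2) \<noteq> F v\<close> of
  different parities are at distance at least \<open>2d + 1\<close>. Call such a \<open>v\<close> a switch if the preceding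
  one has the other parity. Between consecutive switches at distance \<open>2k + 2d + 1\<close> the value at odd
  offsets is a constant \<open>a\<close> (the centre), and \<open>F\<close> at even offsets is \<open>a\<close> plus a word of \<open>k + 1\<close> free signs
  followed by \<open>d\<close> copies of its last letter; the next centre is \<open>a\<close> plus that letter. Hence the centres
  form a closed simple walk of length \<open>2m\<close> equal to the number of switches, and when \<open>m > 0\<close> the range
  of \<open>F\<close> has exactly two elements more than the range of that walk.

  A word has its first and last letter prescribed, so there are \<open>2\<^bsup>k-1\<^esup>\<close> of them for \<open>k > 0\<close>. Counting
  homomorphisms with a marked switch (rotated to the origin) gives, for each closed walk of length
  \<open>2m\<close>, at most \<open>2 \<cdot> 2\<^bsup>n/2\<^esup> x\<^bsup>2m\<^esup>/(2m)!\<close> homomorphisms, where \<open>x = n 2\<^bsup>-d\<^esup>/(4 \<surd>2)\<close>, and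
  asymptotically that many for fixed \<open>m\<close>. Summing the upper bound over \<open>m\<close> and the
  \<open>(2m choose m)\<close> walks bounds the normalising constant, so every point mass of the pair (number of
  switches, size of the range) is asymptotically at least its limit; as the limits sum to 1 this
  forces convergence.\<close>

section \<open>Chains of sign words\<close>

text \<open>The index \<open>k\<close> is half the excess of a block length over its minimum
  \<open>2d + 1\<close>. The indices of \<open>r\<close> blocks filling a period therefore add up to
  \<open>M\<close> with \<open>n = 2M + r(2d + 1)\<close>.\<close>

definition sign_words :: "int \<Rightarrow> int \<Rightarrow> nat \<Rightarrow> int list set" where
  "sign_words s t k = {w. length w = k + 1 \<and> set w \<subseteq> {1, -1} \<and> hd w = s \<and> last w = t}"

text \<open>\<open>s\<close> plays the role of the last letter of a word preceding the first one.
  Splitting off the first word makes the count a convolution over its index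
  \<open>k\<close>.\<close>

fun chains :: "int \<Rightarrow> int list \<Rightarrow> nat \<Rightarrow> int list list set" where
  "chains s [] M = (if M = 0 then {[]} else {})"
| "chains s (t # ts) M = (\<Union>k\<in>{..M}. \<Union>w\<in>sign_words s t k. (#) w ` chains t ts (M - k))"

lemma sign_words_0:
  assumes "s \<in> {1, -1}"
  shows "sign_words s t 0 = (if s = t then {[s]} else {})"
  using assms by (auto simp: sign_words_def length_Suc_conv)

lemma sign_words_Suc:
  assumes "s \<in> {1, -1}" "t \<in> {1, -1}"
  shows "sign_words s t (Suc k) = (\<lambda>u. s # u @ [t]) ` {u. set u \<subseteq> {1, -1} \<and> length u = k}"
proof (intro equalityI subsetI)
  fix w assume w: "w \<in> sign_words s t (Suc k)"
  then obtain x v where v: "w = x # v" "length v = k + 1"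
    by (auto simp: sign_words_def length_Suc_conv)
  then obtain u y where u: "v = u @ [y]" "length u = k"
    by (cases v rule: rev_cases) auto
  from w v u show "w \<in> (\<lambda>u. s # u @ [t]) ` {u. set u \<subseteq> {1, -1} \<and> length u = k}"
    by (auto simp: sign_words_def)
qed (use assms in \<open>auto simp: sign_words_def\<close>)

lemma card_sign_words_Suc:
  assumes "s \<in> {1, -1}" "t \<in> {1, -1}"
  shows "card (sign_words s t (Suc k)) = 2 ^ k"
proof -
  have "inj_on (\<lambda>u. s # u @ [t]) {u. set u \<subseteq> {1, -1} \<and> length u = k}"
    by (auto simp: inj_on_def)
  then show ?thesis
    unfolding sign_words_Suc[OF assms] using card_lists_length_eq[of "{1, -1 :: int}" k]
    by (simp add: card_image numeral_2_eq_2)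
qed

lemma finite_sign_words: "finite (sign_words s t k)"
  by (rule finite_subset[OF _ finite_lists_length_eq[of "{1, -1 :: int}" "k + 1"]])
    (auto simp: sign_words_def)

lemma finite_chains: "finite (chains s ts M)"
  by (induction s ts M rule: chains.induct) (auto simp: finite_sign_words)

lemma card_chains_Cons:
  "card (chains s (t # ts) M) =
     (\<Sum>k\<le>M. card (sign_words s t k) * card (chains t ts (M - k)))"
proof -
  have "card (chains s (t # ts) M) =
      (\<Sum>k\<le>M. card (\<Union>w\<in>sign_words s t k. (#) w ` chains t ts (M - k)))"
    unfolding chains.simps
    by (rule card_UN_disjoint)
      (simp_all add: finite_sign_words finite_chains, auto simp: sign_words_def)
  also have "\<dots> = (\<Sum>k\<le>M. \<Sum>w\<in>sign_words s t k. card ((#) w ` chains t ts (M - k)))"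
    by (intro sum.cong refl card_UN_disjoint) (auto simp: finite_sign_words finite_chains)
  also have "\<dots> = (\<Sum>k\<le>M. card (sign_words s t k) * card (chains t ts (M - k)))"
    by (simp add: card_image)
  finally show ?thesis .
qed

text \<open>For \<open>k > 0\<close> only the \<open>k - 1\<close> inner letters are free; doubling
  clears the halves. A word with \<open>k = 0\<close> exists only if \<open>s = t\<close>, so it is
  counted as one in the upper and as zero in the lower bound, which removes the dependence on the
  signs.\<close>

lemma chains_weights:
  assumes "s \<in> {1, -1}" "t \<in> {1, -1}"
  shows "2 * card (chains s (t # ts) M) \<le>
      2 * card (chains t ts M) + (\<Sum>k=1..M. 2 ^ k * card (chains t ts (M - k)))"
    and "(\<Sum>k=1..M. 2 ^ k * card (chains t ts (M - k))) \<le> 2 * card (chains s (t # ts) M)"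
proof -
  have "(\<Sum>k\<le>M. card (sign_words s t k) * card (chains t ts (M - k))) =
      card (sign_words s t 0) * card (chains t ts M) +
      (\<Sum>k=1..M. card (sign_words s t k) * card (chains t ts (M - k)))"
    by (simp add: atMost_atLeast0 sum.atLeast_Suc_atMost)
  moreover have "2 * (\<Sum>k=1..M. card (sign_words s t k) * card (chains t ts (M - k))) =
      (\<Sum>k=1..M. 2 ^ k * card (chains t ts (M - k)))"
    unfolding sum_distrib_left
  proof (intro sum.cong refl)
    fix k assume "k \<in> {1..M}"
    then obtain j where j: "k = Suc j" by (cases k) auto
    show "2 * (card (sign_words s t k) * card (chains t ts (M - k))) =
        2 ^ k * card (chains t ts (M - k))"
      unfolding j card_sign_words_Suc[OF assms] by simp
  qed
  moreover have "card (sign_words s t 0) \<le> 1"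
    using assms by (simp add: sign_words_0)
  then have "card (sign_words s t 0) * card (chains t ts M) \<le> card (chains t ts M)"
    by (metis mult_le_mono1 mult_1)
  ultimately show "2 * card (chains s (t # ts) M) \<le>
      2 * card (chains t ts M) + (\<Sum>k=1..M. 2 ^ k * card (chains t ts (M - k)))"
    and "(\<Sum>k=1..M. 2 ^ k * card (chains t ts (M - k))) \<le> 2 * card (chains s (t # ts) M)"
    unfolding card_chains_Cons by linarith+
qed

lemma sum_choose_lessThan: "(\<Sum>j<n. j choose r) = n choose Suc r"
  by (cases n) (simp_all add: lessThan_Suc_atMost sum_choose_upper)

text \<open>Only chains with all indices positive are kept. With \<open>r = length ts\<close>, there
  are (M-1 choose r-1) compositions of \<open>M\<close> into \<open>r\<close> positive parts, each
  realised by 2^(M-r) chains; the induction is the hockey-stick sum for these binomials.\<close>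

lemma card_chains_lower:
  assumes "s \<in> {1, -1}" "set ts \<subseteq> {1, -1}" "ts \<noteq> []" "M \<ge> 1"
  shows "2 ^ M * ((M - 1) choose (length ts - 1)) \<le> 2 ^ length ts * card (chains s ts M)"
  using assms
proof (induction ts arbitrary: s M)
  case (Cons t ts)
  have t: "t \<in> {1, -1}" using Cons.prems by auto
  show ?case
  proof (cases "ts = []")
    case True
    have "2 ^ M \<le> (\<Sum>k=1..M. 2 ^ k * card (chains t ts (M - k)))"
      using member_le_sum[where i = M and A = "{1..M}" and f = "\<lambda>k. 2 ^ k * card (chains t ts (M - k))"] Cons.prems True
      by auto
    then show ?thesis using chains_weights(2)[OF Cons.prems(1) t, of ts M] True
      by (simp del: chains.simps)
  next
    case False
    then obtain r where r: "length ts = Suc r" by (cases ts) auto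
    obtain K where K: "M = Suc K" using Cons.prems by (cases M) auto
    have "2 ^ M * (K choose Suc r) = (\<Sum>j<K. 2 ^ M * (j choose r))"
      unfolding sum_choose_lessThan[symmetric] sum_distrib_left ..
    also have "\<dots> = (\<Sum>k=1..K. 2 ^ M * ((M - k - 1) choose r))"
      by (rule sum.reindex_bij_witness[of _ "\<lambda>k. K - k" "\<lambda>j. K - j"]) (auto simp: K)
    also have "\<dots> \<le> (\<Sum>k=1..K. 2 ^ Suc r * (2 ^ k * card (chains t ts (M - k))))"
    proof (rule sum_mono)
      fix k assume k: "k \<in> {1..K}"
      have "2 ^ (M - k) * ((M - k - 1) choose r) \<le> 2 ^ Suc r * card (chains t ts (M - k))"
        using Cons.IH[OF t _ False, of "M - k"] Cons.prems r K k by (simp add: Suc_diff_le)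
      then have "2 ^ k * (2 ^ (M - k) * ((M - k - 1) choose r))
          \<le> 2 ^ k * (2 ^ Suc r * card (chains t ts (M - k)))"
        by (rule mult_le_mono2)
      moreover have "2 ^ M = 2 ^ k * (2 ^ (M - k) :: nat)"
        using k K by (simp flip: power_add)
      ultimately show "2 ^ M * ((M - k - 1) choose r) \<le> 2 ^ Suc r * (2 ^ k * card (chains t ts (M - k)))"
        by (simp add: ac_simps)
    qed
    also have "\<dots> \<le> (\<Sum>k=1..M. 2 ^ Suc r * (2 ^ k * card (chains t ts (M - k))))"
      by (rule sum_mono2) (auto simp: K)
    also have "\<dots> \<le> 2 ^ Suc r * (2 * card (chains s (t # ts) M))"
      unfolding sum_distrib_left[symmetric]
      by (rule mult_le_mono2, rule chains_weights(2)[OF Cons.prems(1) t])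
    finally show ?thesis by (simp add: K r del: chains.simps)
  qed
qed simp

text \<open>Admitting \<open>k = 0\<close> costs two in the upper index per word, because 2 (N
  choose r) + (N choose r+1) <= (N+2 choose r+1). A single word is excluded: for
  \<open>M = 0\<close> and \<open>s = t\<close> the bound would read 2 <= 1. Hence two words form
  the base case.\<close>

lemma card_chains_upper:
  assumes "s \<in> {1, -1}" "set ts \<subseteq> {1, -1}" "length ts \<ge> 2"
  shows "2 ^ length ts * card (chains s ts M) \<le>
    2 ^ M * ((M + 2 * length ts) choose (length ts - 1))"
  using assms
proof (induction ts arbitrary: s M)
  case (Cons t ts)
  have t: "t \<in> {1, -1}" using Cons.prems by auto
  note w = chains_weights(1)[OF Cons.prems(1) t, of ts M]
  consider u where "ts = [u]" | "length ts \<ge> 2" using Cons.prems(3) by (cases ts; cases "tl ts") auto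
  then show ?case
  proof cases
    case (1 u)
    then have u: "u \<in> {1, -1}" using Cons.prems by auto
    \<comment> \<open>The extra 1 at \<open>j = 0\<close> accounts for the one-letter word. In the
      convolution below it appears only in the term \<open>k = M\<close>.\<close>
    have c1: "2 * card (chains t ts j) \<le> 2 ^ j + (if j = 0 then 1 else 0)" for j
    proof -
      have "(\<Sum>k=1..j. 2 ^ k * card (chains u [] (j - k))) = (\<Sum>k=1..j. if k = j then 2 ^ j else 0)"
        by (rule sum.cong) auto
      also have "\<dots> = (if j = 0 then 0 else 2 ^ j)" by auto
      finally show ?thesis
        using chains_weights(1)[OF t u, of "[]" j] by (auto simp: 1 simp del: chains.simps(2) split: if_splits)
    qed
    have "2 * (\<Sum>k=1..M. 2 ^ k * card (chains t ts (M - k)))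
        \<le> (\<Sum>k=1..M. 2 ^ M + (if k = M then 2 ^ M else 0))"
      unfolding sum_distrib_left
    proof (rule sum_mono)
      fix k assume "k \<in> {1..M}"
      then have p: "2 ^ M = 2 ^ k * (2 ^ (M - k) :: nat)" by (simp flip: power_add)
      have "2 ^ k * (2 * card (chains t ts (M - k)))
          \<le> 2 ^ k * (2 ^ (M - k) + (if M - k = 0 then 1 else 0))"
        by (rule mult_le_mono2, rule c1)
      then show "2 * (2 ^ k * card (chains t ts (M - k))) \<le> 2 ^ M + (if k = M then 2 ^ M else 0)"
        using \<open>k \<in> {1..M}\<close> unfolding distrib_left p[symmetric] by (auto split: if_splits)
    qed
    also have "\<dots> \<le> M * 2 ^ M + (if M = 0 then 0 else 2 ^ M)"
      by (simp add: sum.distrib)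
    finally have "4 * card (chains s (t # ts) M) \<le>
        2 * (2 ^ M + (if M = 0 then 1 else 0)) + (M * 2 ^ M + (if M = 0 then 0 else 2 ^ M))"
      using add_mono[OF mult_le_mono2[OF c1[of M], of 2]] mult_le_mono2[OF w, of 2]
      by (fastforce intro: order_trans)
    also have "\<dots> \<le> 2 ^ M * (M + 4)" by (auto simp: algebra_simps)
    finally show ?thesis by (simp add: 1 del: chains.simps)
  next
    case 2
    then obtain r where r: "length ts = Suc r" by (cases ts) auto
    let ?R = "2 * Suc r"
    have IH: "2 ^ Suc r * card (chains t ts j) \<le> 2 ^ j * ((j + ?R) choose r)" for j
      using Cons.IH[OF t _ 2, of j] Cons.prems by (simp add: r)
    have "2 ^ Suc r * (\<Sum>k=1..M. 2 ^ k * card (chains t ts (M - k)))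
        \<le> (\<Sum>k=1..M. 2 ^ M * ((M - k + ?R) choose r))"
      unfolding sum_distrib_left
    proof (rule sum_mono)
      fix k assume "k \<in> {1..M}"
      then have p: "2 ^ M = 2 ^ k * (2 ^ (M - k) :: nat)" by (simp flip: power_add)
      have "2 ^ k * (2 ^ Suc r * card (chains t ts (M - k)))
          \<le> 2 ^ k * (2 ^ (M - k) * ((M - k + ?R) choose r))"
        by (rule mult_le_mono2, rule IH)
      then show "2 ^ Suc r * (2 ^ k * card (chains t ts (M - k))) \<le> 2 ^ M * ((M - k + ?R) choose r)"
        unfolding p by (simp only: ac_simps)
    qed
    also have "\<dots> = (\<Sum>i\<in>{?R..<M + ?R}. 2 ^ M * (i choose r))"
      by (rule sum.reindex_bij_witness[of _ "\<lambda>i. M + ?R - i" "\<lambda>k. M - k + ?R"]) auto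
    also have "\<dots> \<le> (\<Sum>i<M + ?R. 2 ^ M * (i choose r))"
      by (rule sum_mono2) auto
    also have "\<dots> = 2 ^ M * ((M + ?R) choose Suc r)"
      unfolding sum_choose_lessThan[symmetric] sum_distrib_left ..
    finally have a: "2 ^ Suc r * (\<Sum>k=1..M. 2 ^ k * card (chains t ts (M - k)))
        \<le> 2 ^ M * ((M + ?R) choose Suc r)" .
    have "2 ^ Suc r * (2 * card (chains s (t # ts) M)) \<le>
        2 ^ Suc r * (2 * card (chains t ts M) + (\<Sum>k=1..M. 2 ^ k * card (chains t ts (M - k))))"
      using w by (rule mult_le_mono2)
    also have "\<dots> \<le> 2 * (2 ^ M * ((M + ?R) choose r)) + 2 ^ M * ((M + ?R) choose Suc r)"
      unfolding distrib_left using a IH[of M] by linarith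
    \<comment> \<open>Pascal's rule absorbs one of the two copies of the smaller binomial; the other
      is absorbed after its upper index is raised by one.\<close>
    also have "\<dots> = 2 ^ M * ((Suc (M + ?R) choose Suc r) + ((M + ?R) choose r))"
      by (simp add: algebra_simps)
    also have "\<dots> \<le> 2 ^ M * ((Suc (M + ?R) choose Suc r) + (Suc (M + ?R) choose r))"
      by (intro mult_le_mono2 add_left_mono binomial_right_mono) simp
    also have "\<dots> = 2 ^ M * ((M + 2 * length (t # ts)) choose (length (t # ts) - 1))"
      by (simp add: r)
    finally show ?thesis by (simp add: r del: chains.simps)
  qed
qed simp

section \<open>Decomposition into blocks\<close>

fun linked :: "int \<Rightarrow> int list list \<Rightarrow> bool" where
  "linked s [] \<longleftrightarrow> True"
| "linked s (w # ws) \<longleftrightarrow> w \<noteq> [] \<and> set w \<subseteq> {1, -1} \<and> hd w = s \<and> linked (last w) ws"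

lemma mem_chains_iff:
  "ws \<in> chains s ts M \<longleftrightarrow>
     linked s ws \<and> map last ws = ts \<and> sum_list (map (\<lambda>w. length w - 1) ws) = M"
proof (induction ws arbitrary: s ts M)
  case Nil
  show ?case by (cases ts) auto
next
  case (Cons w ws)
  show ?case
  proof (cases ts)
    case (Cons t ts')
    have "w # ws \<in> chains s (t # ts') M \<longleftrightarrow>
        (\<exists>k\<le>M. w \<in> sign_words s t k \<and> ws \<in> chains t ts' (M - k))"
      by auto
    also have "\<dots> \<longleftrightarrow> length w - 1 \<le> M \<and> w \<in> sign_words s t (length w - 1)
        \<and> ws \<in> chains t ts' (M - (length w - 1))"
      by (auto simp: sign_words_def)
    also have "\<dots> \<longleftrightarrow> linked s (w # ws) \<and> map last (w # ws) = t # ts' \<and>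
        sum_list (map (\<lambda>w. length w - 1) (w # ws)) = M"
      unfolding Cons.IH by (cases w) (auto simp: sign_words_def)
    finally show ?thesis using Cons by simp
  qed auto
qed

lemma linked_append:
  "linked s (ws @ ws') \<longleftrightarrow> linked s ws \<and> linked (last (s # map last ws)) ws'"
  by (induction ws arbitrary: s) auto

lemma word_signs:
  assumes "w \<noteq> []" "set w \<subseteq> {1, -1 :: int}"
  shows "hd w \<in> {1, -1}" "last w \<in> {1, -1}"
  using assms hd_in_set last_in_set by blast+

section \<open>Local homomorphisms, switches and blocks\<close>

definition local_hom :: "nat \<Rightarrow> (int \<Rightarrow> int) \<Rightarrow> bool" where
  "local_hom d F \<longleftrightarrow> (\<forall>i j. odd (j - i) \<longrightarrow> \<bar>j - i\<bar> \<le> 2 * int d + 1 \<longrightarrow> \<bar>F j - F i\<bar> = 1)"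

definition jump :: "(int \<Rightarrow> int) \<Rightarrow> int \<Rightarrow> bool" where
  "jump F v \<longleftrightarrow> F (v + 2) \<noteq> F v"

definition switch :: "(int \<Rightarrow> int) \<Rightarrow> int \<Rightarrow> bool" where
  "switch F v \<longleftrightarrow> jump F v \<and> (\<exists>u<v. jump F u \<and> odd (v - u) \<and> (\<forall>i. u < i \<and> i < v \<longrightarrow> \<not> jump F i))"

definition jump_sign :: "(int \<Rightarrow> int) \<Rightarrow> int \<Rightarrow> int" where
  "jump_sign F v = (F (v + 2) - F v) div 2"

text \<open>For \<open>length w = k + 1\<close> this is \<open>2k + 2d + 1\<close>. Of the
  \<open>d\<close> copies of the last letter that follow the word, the last one falls on the first
  vertex of the next block, where it is the new centre.\<close>

definition block_len :: "nat \<Rightarrow> int list \<Rightarrow> nat" where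
  "block_len d w = 2 * length w + 2 * d - 1"

text \<open>The index \<open>i\<close> belongs to the vertex at offset \<open>i + 1\<close> from the
  start \<open>v\<close>, so even indices are the odd offsets carrying the centre.\<close>

definition block_val :: "int \<Rightarrow> int list \<Rightarrow> nat \<Rightarrow> int" where
  "block_val a w i =
     (if even i then a else a + (if i div 2 < length w then w ! (i div 2) else last w))"

definition is_block :: "nat \<Rightarrow> (int \<Rightarrow> int) \<Rightarrow> int \<Rightarrow> int \<Rightarrow> int list \<Rightarrow> bool" where
  "is_block d F v a w \<longleftrightarrow> (\<forall>i<block_len d w. F (v + 1 + int i) = block_val a w i)"

fun blocks :: "nat \<Rightarrow> (int \<Rightarrow> int) \<Rightarrow> int \<Rightarrow> int \<Rightarrow> int list list \<Rightarrow> bool" where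
  "blocks d F v a [] \<longleftrightarrow> True"
| "blocks d F v a (w # ws) \<longleftrightarrow>
     is_block d F v a w \<and> blocks d F (v + int (block_len d w)) (a + last w) ws"

definition total_len :: "nat \<Rightarrow> int list list \<Rightarrow> nat" where
  "total_len d ws = sum_list (map (block_len d) ws)"

lemma total_len_simps [simp]:
  "total_len d [] = 0"
  "total_len d (w # ws) = block_len d w + total_len d ws"
  "total_len d (ws @ ws') = total_len d ws + total_len d ws'"
  by (simp_all add: total_len_def)

lemma total_len_linked:
  "linked s ws \<Longrightarrow> total_len d ws =
    2 * sum_list (map (\<lambda>w. length w - 1) ws) + length ws * (2 * d + 1)"
proof (induction ws arbitrary: s)
  case (Cons w ws)
  then have "length w \<ge> 1" by (cases w) auto
  with Cons.IH[of "last w"] Cons.prems show ?case by (auto simp: block_len_def)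
qed simp

lemma blocks_append:
  "blocks d F v a (ws @ ws') \<longleftrightarrow>
     blocks d F v a ws \<and> blocks d F (v + int (total_len d ws)) (a + sum_list (map last ws)) ws'"
  by (induction ws arbitrary: v a) (auto simp: add.assoc)

lemma is_block_odd:
  assumes "is_block d F v a w" "v < x" "x \<le> v + int (block_len d w)" "odd (x - v)"
  shows "F x = a"
proof -
  define i where "i = nat (x - v - 1)"
  have x: "x = v + 1 + int i" "even i" using assms(2,4) by (auto simp: i_def even_nat_iff)
  have "i < block_len d w" using x assms(3) by linarith
  then show ?thesis using assms(1) x by (auto simp: is_block_def block_val_def)
qed

lemma is_block_even:
  assumes "is_block d F v a w" "v < x" "x \<le> v + int (block_len d w)" "even (x - v)"
    "w \<noteq> []"
  shows "F x - a \<in> set w"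
    and "2 * int (length w) \<le> x - v \<Longrightarrow> F x = a + last w"
    and "x = v + 2 \<Longrightarrow> F x = a + hd w"
proof -
  define i where "i = nat (x - v - 1)"
  have x: "x = v + 1 + int i" "odd i" using assms(2,4) by (auto simp: i_def even_nat_iff)
  have "i < block_len d w" using x assms(3) by linarith
  then have v: "F x = a + (if i div 2 < length w then w ! (i div 2) else last w)"
    using assms(1) x by (auto simp: is_block_def block_val_def)
  then show "F x - a \<in> set w" using assms(5) by auto
  show "F x = a + last w" if "2 * int (length w) \<le> x - v"
  proof -
    have "i div 2 < length w \<Longrightarrow> i div 2 = length w - 1"
      using that x by (auto elim!: oddE)
    then show ?thesis using v assms(5) by (auto simp: last_conv_nth)
  qed
  show "F x = a + hd w" if "x = v + 2"
    using v x that assms(5) by (auto simp: hd_conv_nth add.commute)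
qed

lemma is_blockI:
  assumes "\<And>x. v < x \<Longrightarrow> x \<le> v + int (block_len d w) \<Longrightarrow> odd (x - v) \<Longrightarrow> F x = a"
    and "\<And>i. i < length w \<Longrightarrow> F (v + 2 * int i + 2) = a + w ! i"
    and "\<And>x. v + 2 * int (length w) \<le> x \<Longrightarrow> x \<le> v + int (block_len d w) \<Longrightarrow> even (x - v) \<Longrightarrow>
      F x = a + last w"
  shows "is_block d F v a w"
  unfolding is_block_def
proof (intro allI impI)
  fix i assume i: "i < block_len d w"
  show "F (v + 1 + int i) = block_val a w i"
  proof (cases "even i")
    case True
    then show ?thesis using assms(1)[of "v + 1 + int i"] i by (simp add: block_val_def)
  next
    case False
    then obtain j where j: "i = 2 * j + 1" by (elim oddE)
    show ?thesis
    proof (cases "j < length w")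
      case True
      then show ?thesis using assms(2)[of j] by (simp add: j block_val_def add_ac)
    next
      case False
      then show ?thesis using assms(3)[of "v + 1 + int i"] i j by (simp add: block_val_def)
    qed
  qed
qed

lemma is_block_cong:
  assumes "\<And>x. v < x \<Longrightarrow> x \<le> v + int (block_len d w) \<Longrightarrow> F x = G x"
  shows "is_block d F v a w \<longleftrightarrow> is_block d G v a w"
  unfolding is_block_def using assms by auto

lemma blocks_cong:
  assumes "\<And>x. v < x \<Longrightarrow> x \<le> v + int (total_len d ws) \<Longrightarrow> F x = G x"
  shows "blocks d F v a ws \<longleftrightarrow> blocks d G v a ws"
  using assms
proof (induction ws arbitrary: v a)
  case (Cons w ws)
  have "is_block d F v a w \<longleftrightarrow> is_block d G v a w"
    by (rule is_block_cong) (use Cons.prems in auto)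
  moreover have "blocks d F (v + int (block_len d w)) b ws
      \<longleftrightarrow> blocks d G (v + int (block_len d w)) b ws" for b
    by (rule Cons.IH) (use Cons.prems in auto)
  ultimately show ?case by simp
qed simp

fun path_of :: "nat \<Rightarrow> int \<Rightarrow> int \<Rightarrow> int list list \<Rightarrow> int \<Rightarrow> int" where
  "path_of d v a [] x = a"
| "path_of d v a (w # ws) x =
     (if x \<le> v + int (block_len d w) then block_val a w (nat (x - v - 1))
      else path_of d (v + int (block_len d w)) (a + last w) ws x)"

lemma blocks_path_of: "blocks d (path_of d v a ws) v a ws"
proof (induction ws arbitrary: v a)
  case (Cons w ws)
  have "blocks d (path_of d v a (w # ws)) (v + int (block_len d w)) (a + last w) ws \<longleftrightarrow>
      blocks d (path_of d (v + int (block_len d w)) (a + last w) ws)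
        (v + int (block_len d w)) (a + last w) ws"
    by (rule blocks_cong) auto
  then have "blocks d (path_of d v a (w # ws)) (v + int (block_len d w)) (a + last w) ws"
    using Cons.IH by simp
  moreover have "is_block d (path_of d v a (w # ws)) v a w"
    by (auto simp: is_block_def)
  ultimately show ?case by (simp del: path_of.simps)
qed simp

lemma blocks_shift:
  "blocks d (\<lambda>x. F (x + c)) v a ws \<longleftrightarrow> blocks d F (v + c) a ws"
  by (induction ws arbitrary: v a) (auto simp: is_block_def algebra_simps)

lemma blocks_determine:
  assumes "blocks d F v a ws" "blocks d G v a ws" "v < x" "x \<le> v + int (total_len d ws)"
  shows "F x = G x"
  using assms
proof (induction ws arbitrary: v a)
  case (Cons w ws)
  show ?case
  proof (cases "x \<le> v + int (block_len d w)")
    case True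
    then have "x = v + 1 + int (nat (x - v - 1))" "nat (x - v - 1) < block_len d w"
      using Cons.prems by auto
    then show ?thesis using Cons.prems unfolding blocks.simps is_block_def by metis
  next
    case False
    then show ?thesis using Cons.IH[of "v + int (block_len d w)" "a + last w"] Cons.prems by auto
  qed
qed simp

lemma is_block_word_unique:
  assumes "is_block d F v a w" "is_block d F v a w'" "length w = length w'" "d \<ge> 1"
  shows "w = w'"
proof (rule nth_equalityI[OF assms(3)])
  fix i assume i: "i < length w"
  then have "2 * i + 1 < block_len d w" "2 * i + 1 < block_len d w'"
    using assms(3,4) by (auto simp: block_len_def)
  then have "block_val a w (2 * i + 1) = block_val a w' (2 * i + 1)"
    using assms(1,2) unfolding is_block_def by metis
  then show "w ! i = w' ! i" using i assms(3) by (simp add: block_val_def)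
qed

text \<open>If \<open>w'\<close> were longer, its centre \<open>a\<close> would still occupy the
  offset \<open>block_len d w + 2\<close>, which is odd; the second block of the other decomposition
  has the value \<open>a + 2 * last w\<close> there. Used in both directions, this shows that
  \<open>F\<close> determines the length of its first block.\<close>

lemma first_block_length_le:
  assumes "linked s (w # ws)" "blocks d F v a (w # ws)" "is_block d F v a w'"
    and "block_len d w' \<le> total_len d (w # ws)" "d \<ge> 1"
  shows "length w' \<le> length w"
proof (rule ccontr)
  assume "\<not> ?thesis"
  then have len: "block_len d w + 2 \<le> block_len d w'" using assms by (auto simp: block_len_def)
  then obtain w2 ws2 where ws: "ws = w2 # ws2" using assms(4) by (cases ws) auto
  let ?v = "v + int (block_len d w)"
  have b: "is_block d F ?v (a + last w) w2" and w2: "w2 \<noteq> []" "hd w2 = last w"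
    using assms(1,2) ws by auto
  have "2 \<le> block_len d w2" using assms(5) w2 by (cases w2) (auto simp: block_len_def)
  then have "F (?v + 2) = a + last w + hd w2"
    using is_block_even(3)[OF b, of "?v + 2"] w2 by simp
  moreover have "F (?v + 2) = a"
  proof (rule is_block_odd[OF assms(3)])
    show "odd (?v + 2 - v)" using assms by (auto simp: block_len_def)
  qed (use len in auto)
  moreover have "last w \<in> {1, -1}" using assms(1) by (intro word_signs) auto
  ultimately show False using w2 by auto
qed

lemma blocks_unique:
  assumes "linked s ws" "linked s' ws'" "blocks d F v a ws" "blocks d F v a ws'"
    and "total_len d ws = total_len d ws'" "d \<ge> 1"
  shows "ws = ws'"
  using assms
proof (induction ws arbitrary: ws' s s' v a)
  case Nil
  then show ?case by (cases ws') (auto simp: block_len_def)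
next
  case (Cons w ws)
  have "block_len d w > 0" using Cons.prems by (cases w) (auto simp: block_len_def)
  then obtain w' us where ws': "ws' = w' # us" using Cons.prems by (cases ws') auto
  have "length w' \<le> length w"
    by (rule first_block_length_le[of s w ws d F v a]) (use Cons.prems ws' in auto)
  moreover have "length w \<le> length w'"
    by (rule first_block_length_le[of s' w' us d F v a]) (use Cons.prems ws' in auto)
  ultimately have w: "w = w'"
    using is_block_word_unique[of d F v a w w'] Cons.prems ws' by auto
  moreover have "ws = us"
    using Cons.IH[of "last w" "last w'" us "v + int (block_len d w)" "a + last w"] Cons.prems ws' w
    by auto
  ultimately show ?case using ws' by simp
qed

text \<open>Within a block, vertices of opposite parity carry the centre and a value next to it.
  Blocks have length at least \<open>2d + 1\<close>, so any other pair meets two consecutive blocks,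
  and there the constant tail of the first word settles the case of even offsets.\<close>

lemma linked_blocks_local_hom:
  assumes "linked s ws" "blocks d F v a ws" "v < p" "p < q" "q \<le> v + int (total_len d ws)"
    and "odd (q - p)" "q - p \<le> 2 * int d + 1"
  shows "\<bar>F q - F p\<bar> = 1"
  using assms
proof (induction ws arbitrary: s v a)
  case (Cons w ws)
  let ?v = "v + int (block_len d w)"
  have w: "w \<noteq> []" "set w \<subseteq> {1, -1}" and B: "is_block d F v a w" using Cons.prems by auto
  have last: "last w \<in> {1, -1}" using w by (rule word_signs)
  have len: "int (block_len d w) = 2 * int (length w) + 2 * int d - 1"
    using w by (cases w) (auto simp: block_len_def)
  have even_pm: "F x - a \<in> {1, -1}" if "v < x" "x \<le> ?v" "even (x - v)" for x
    using is_block_even(1)[OF B that] w by auto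
  consider "q \<le> ?v" | "?v < p" | "p \<le> ?v" "?v < q" by linarith
  then show ?case
  proof cases
    case 1
    then consider "odd (q - v)" "even (p - v)" | "even (q - v)" "odd (p - v)"
      using Cons.prems(6) by fastforce
    then show ?thesis
      using is_block_odd[OF B, of p] is_block_odd[OF B, of q] even_pm[of p] even_pm[of q] 1 Cons.prems
      by cases auto
  next
    case 2
    then show ?thesis using Cons.IH[of "last w" ?v "a + last w"] Cons.prems by auto
  next
    case 3
    then obtain w2 ws2 where ws: "ws = w2 # ws2" using Cons.prems by (cases ws) auto
    have B2: "is_block d F ?v (a + last w) w2" and w2: "w2 \<noteq> []" "set w2 \<subseteq> {1, -1}"
      using Cons.prems ws by auto
    have "int (block_len d w2) \<ge> 2 * int d + 1" using w2 by (cases w2) (auto simp: block_len_def)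
    then have q: "q \<le> ?v + int (block_len d w2)" using 3 Cons.prems by linarith
    show ?thesis
    proof (cases "odd (q - ?v)")
      case True
      have "odd (p - v)" using True Cons.prems(6) len by auto
      then have "F p = a" using is_block_odd[OF B, of p] 3 Cons.prems by auto
      moreover have "F q = a + last w" using is_block_odd[OF B2 _ q True] 3 by auto
      ultimately show ?thesis using last by auto
    next
      case False
      have "even (p - v)" using False Cons.prems(6) len by auto
      \<comment> \<open>\<open>q\<close> has offset at least two in the second block, so
        \<open>q - p <= 2d + 1\<close> forces \<open>p\<close> into the constant tail. This is what
        fixes the length of the tail.\<close>
      moreover have "2 * int (length w) \<le> p - v"
        using 3 Cons.prems False len \<open>even (p - v)\<close> by presburger
      ultimately have "F p = a + last w" using is_block_even(2)[OF B, of p] w 3 Cons.prems by auto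
      moreover have "F q - (a + last w) \<in> {1, -1}"
        using is_block_even(1)[OF B2 _ q] 3 False w2 by auto
      ultimately show ?thesis by auto
    qed
  qed
qed simp

text \<open>The odd offsets all carry \<open>a\<close>, so jumps before the end of the block sit at
  even offsets, whereas the end is at an odd one. Since \<open>v\<close> itself is a jump, there is
  a last jump before the end, and its parity is the other one.\<close>

lemma switch_after_block:
  assumes B: "is_block d F v a w" and w: "w \<noteq> []" "set w \<subseteq> {1, -1}" and d: "d \<ge> 1"
    and "F v = a - hd w" "F (v + int (block_len d w) + 2) \<noteq> a"
  shows "switch F (v + int (block_len d w))"
proof -
  let ?v = "v + int (block_len d w)"
  have len: "int (block_len d w) = 2 * int (length w) + 2 * int d - 1" "length w \<ge> 1"
    using w by (cases w; auto simp: block_len_def)+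
  define U where "U = {i\<in>{v..<?v}. jump F i}"
  have "F (v + 2) = a + hd w" using is_block_even(3)[OF B, of "v + 2"] w len d by auto
  moreover have "hd w \<in> {1, -1}" using w by (rule word_signs)
  ultimately have "v \<in> U" using assms(5) len d by (auto simp: U_def jump_def)
  then have "U \<noteq> {}" by auto
  moreover have "finite U" by (rule finite_subset[of _ "{v..<?v}"]) (auto simp: U_def)
  ultimately have U: "finite U" "U \<noteq> {}" by auto
  define u where "u = Max U"
  have "u \<in> U" using Max_in[OF U] by (simp add: u_def)
  then have u: "v \<le> u" "u < ?v" "jump F u" by (auto simp: U_def)
  have "even (u - v)"
  proof (rule ccontr)
    assume o: "odd (u - v)"
    then have "u \<noteq> v" by auto
    have "u + 2 \<le> ?v" using o u len by presburger
    then have "F u = a" "F (u + 2) = a"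
      using is_block_odd[OF B, of u] is_block_odd[OF B, of "u + 2"] o u \<open>u \<noteq> v\<close> by auto
    then show False using u by (simp add: jump_def)
  qed
  then have "odd (?v - u)" using len by presburger
  moreover have "\<not> jump F i" if "u < i" "i < ?v" for i
  proof
    assume "jump F i"
    then have "i \<in> U" using that u by (auto simp: U_def)
    then show False using Max_ge[OF U(1), of i] that by (auto simp: u_def)
  qed
  moreover have "F ?v = a" using is_block_odd[OF B, of ?v] len by auto
  ultimately show ?thesis using u assms(6) by (auto simp: switch_def jump_def)
qed

text \<open>Block lengths are odd, so the last vertex carries the centre of the last block, from
  which the final step has not yet been taken.\<close>

lemma blocks_end:
  assumes "linked s ws" "blocks d F v a ws" "ws \<noteq> []"
  shows "F (v + int (total_len d ws)) = a + sum_list (map last ws) - last (map last ws)"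
  using assms
proof (induction ws arbitrary: s v a)
  case (Cons w ws)
  show ?case
  proof (cases "ws = []")
    case True
    have "w \<noteq> []" using Cons.prems by auto
    then have "odd (block_len d w)" "block_len d w > 0" by (cases w; simp add: block_len_def)+
    then show ?thesis
      using is_block_odd[of d F v a w "v + int (block_len d w)"] Cons.prems True by auto
  next
    case False
    then show ?thesis
      using Cons.IH[of "last w" "v + int (block_len d w)" "a + last w"] Cons.prems
      by (auto simp: add.assoc)
  qed
qed simp

lemma switch_between_blocks:
  assumes "linked s (ws @ w' # ws')" "blocks d F v a (ws @ w' # ws')" "ws \<noteq> []" "F v = a - s" "d \<ge> 1"
  shows "switch F (v + int (total_len d ws))"
  using assms
proof (induction ws arbitrary: s v a)
  case (Cons w ws)
  let ?v = "v + int (block_len d w)"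
  have w: "w \<noteq> []" "set w \<subseteq> {1, -1}" "hd w = s" and B: "is_block d F v a w" using Cons.prems by auto
  show ?case
  proof (cases "ws = []")
    case True
    then have B2: "is_block d F ?v (a + last w) w'" and w': "w' \<noteq> []" "hd w' = last w"
      using Cons.prems by auto
    have "2 \<le> block_len d w'" using w' Cons.prems by (cases w') (auto simp: block_len_def)
    then have "F (?v + 2) = a + last w + last w"
      using is_block_even(3)[OF B2, of "?v + 2"] w' by auto
    moreover have "last w \<in> {1, -1}" using w(1,2) by (rule word_signs)
    ultimately have "F (?v + 2) \<noteq> a" by auto
    then show ?thesis
      using switch_after_block[OF B w(1,2)] Cons.prems True w by auto
  next
    case False
    have "F ?v = a" using blocks_end[of s "[w]" d F v a] Cons.prems by auto
    then show ?thesis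
      using Cons.IH[of "last w" ?v "a + last w"] Cons.prems False by (auto simp: add.assoc)
  qed
qed simp

section \<open>Jumps of local homomorphisms and the existence of the block decomposition\<close>

lemma jump_sign:
  assumes "local_hom d F" "jump F v"
  shows "jump_sign F v \<in> {1, -1}" "F (v + 2) = F v + 2 * jump_sign F v"
    "F (v + 1) = F v + jump_sign F v"
proof -
  have "\<bar>F (v + 1) - F v\<bar> = 1" "\<bar>F (v + 2) - F (v + 1)\<bar> = 1"
    using assms(1) by (auto simp: local_hom_def)
  moreover have "F (v + 2) \<noteq> F v" using assms(2) by (simp add: jump_def)
  ultimately have "F (v + 2) - F v = 2 \<and> F (v + 1) = F v + 1 \<or>
      F (v + 2) - F v = -2 \<and> F (v + 1) = F v - 1"
    by linarith
  then show "jump_sign F v \<in> {1, -1}" "F (v + 2) = F v + 2 * jump_sign F v"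
    "F (v + 1) = F v + jump_sign F v"
    by (auto simp: jump_sign_def)
qed

text \<open>Both \<open>v\<close> and \<open>v + 2\<close> lie within \<open>2d + 1\<close> of
  \<open>j\<close> at odd distance, and their values differ by two, so \<open>F j\<close> is forced
  to be the midpoint.\<close>

lemma jump_neighbour:
  assumes "local_hom d F" "jump F v" "odd (j - v)" "v + 1 - 2 * int d \<le> j" "j \<le> v + 1 + 2 * int d"
  shows "F j = F v + jump_sign F v"
proof -
  have "\<bar>F j - F v\<bar> = 1" "\<bar>F j - F (v + 2)\<bar> = 1"
    using assms unfolding local_hom_def by (auto simp: abs_if)
  then show ?thesis using jump_sign[OF assms(1,2)] by auto
qed

text \<open>Otherwise \<open>jump_neighbour\<close> at \<open>i\<close> fixes the values at
  \<open>j\<close> and at \<open>j + 2\<close> to be equal, contradicting the jump at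
  \<open>j\<close>.\<close>

lemma jumps_apart:
  assumes "local_hom d F" "jump F i" "jump F j" "i < j" "odd (j - i)"
  shows "2 * int d + 1 \<le> j - i"
proof (rule ccontr)
  assume "\<not> ?thesis"
  then have "j + 2 \<le> i + 1 + 2 * int d" using assms(5) by presburger
  then have "F (j + 2) = F j"
    using jump_neighbour[OF assms(1,2), of j] jump_neighbour[OF assms(1,2), of "j + 2"] assms(4,5)
    by auto
  then show False using assms(3) by (simp add: jump_def)
qed

text \<open>The first jump at odd distance after \<open>u\<close> is a switch: the jump immediately
  before it exists, since \<open>u\<close> is a candidate, and by minimality has the parity of
  \<open>u\<close>.\<close>

lemma switch_if_odd_jump:
  assumes "jump F u" "jump F v" "u < v" "odd (v - u)"
  obtains w where "u < w" "w \<le> v" "odd (w - u)" "switch F w"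
proof -
  define A where "A = {i\<in>{u..v}. jump F i \<and> odd (i - u)}"
  have "finite A" by (rule finite_subset[of _ "{u..v}"]) (auto simp: A_def)
  moreover have "v \<in> A" using assms by (auto simp: A_def)
  ultimately have A: "finite A" "A \<noteq> {}" by auto
  define w where "w = Min A"
  have "w \<in> A" using Min_in[OF A] by (simp add: w_def)
  then have w: "u \<le> w" "w \<le> v" "jump F w" "odd (w - u)" by (auto simp: A_def)
  then have uw: "u < w" by (cases "u = w") auto
  define B where "B = {i\<in>{u..<w}. jump F i}"
  have "finite B" by (rule finite_subset[of _ "{u..<w}"]) (auto simp: B_def)
  moreover have "u \<in> B" using assms uw by (auto simp: B_def)
  ultimately have B: "finite B" "B \<noteq> {}" by auto
  define m where "m = Max B"
  have "m \<in> B" using Max_in[OF B] by (simp add: m_def)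
  then have m: "u \<le> m" "m < w" "jump F m" by (auto simp: B_def)
  have "m \<notin> A" using Min_le[OF A(1), of m] m by (auto simp: w_def)
  then have "even (m - u)" using m w by (auto simp: A_def)
  then have "odd (w - m)" using w by presburger
  moreover have "\<not> jump F i" if "m < i" "i < w" for i
    using Max_ge[OF B(1), of i] that m by (auto simp: m_def B_def)
  ultimately have "switch F w" using w m by (auto simp: switch_def)
  then show thesis using that w uw by blast
qed

text \<open>A jump before \<open>v'\<close> at odd distance from \<open>v\<close> would create a
  switch in between, so the odd offsets are constant. The jump at \<open>v'\<close> pins the last
  even offsets through \<open>jump_neighbour\<close>, and the even offsets before them are read off
  as the word.\<close>

lemma block_between_switches:
  assumes hom: "local_hom d F" and v: "switch F v" "switch F v'" "v < v'"
    and none: "\<And>i. v < i \<Longrightarrow> i < v' \<Longrightarrow> \<not> switch F i"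
  obtains w where "w \<noteq> []" "set w \<subseteq> {1, -1}" "hd w = jump_sign F v" "last w = jump_sign F v'"
    "v + int (block_len d w) = v'" "is_block d F v (F (v + 1)) w" "F (v' + 1) = F (v + 1) + last w"
proof -
  define a where "a = F (v + 1)"
  have j: "jump F v" "jump F v'" using v by (auto simp: switch_def)
  note s = jump_sign[OF hom j(1)] and s' = jump_sign[OF hom j(2)]
  have even_jump: "even (i - v)" if "v \<le> i" "i < v'" "jump F i" for i
  proof (rule ccontr)
    assume o: "odd (i - v)"
    then have "v < i" using that by (cases "i = v") auto
    from switch_if_odd_jump[OF j(1) that(3) this o] obtain w where "v < w" "w \<le> i" "switch F w" .
    then show False using none[of w] that by auto
  qed
  obtain u where u: "u < v'" "jump F u" "odd (v' - u)" "\<And>i. u < i \<Longrightarrow> i < v' \<Longrightarrow> \<not> jump F i"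
    using v(2) by (auto simp: switch_def)
  have uv: "v \<le> u" using u(4)[of v] j v by force
  then have "even (u - v)" using even_jump u by auto
  then have odd_vv': "odd (v' - v)" using u by presburger
  have far: "2 * int d + 1 \<le> v' - v" using jumps_apart[OF hom u(2) j(2) u(1,3)] uv by auto
  \<comment> \<open>By \<open>far\<close> and the parity of \<open>v' - v\<close> the quotient is
    exact and nonnegative.\<close>
  define k where "k = nat ((v' - v - 2 * int d - 1) div 2)"
  have k: "v' = v + 2 * int k + 2 * int d + 1" using far odd_vv' by (auto simp: k_def)
  have centre_aux: "v + 1 + 2 * int i \<le> v' \<Longrightarrow> F (v + 1 + 2 * int i) = a" for i
  proof (induction i)
    case (Suc i)
    have "\<not> jump F (v + 1 + 2 * int i)" using even_jump[of "v + 1 + 2 * int i"] Suc.prems by auto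
    then show ?case using Suc by (simp add: jump_def algebra_simps)
  qed (simp add: a_def)
  have centre: "F x = a" if "v < x" "x \<le> v'" "odd (x - v)" for x
    using centre_aux[of "nat ((x - v - 1) div 2)"] that by auto
  \<comment> \<open>The lower limit equals \<open>v' + 1 - 2d\<close>, the left end of the window of
    \<open>jump_neighbour\<close> at \<open>v'\<close>. The vertex \<open>v' + 1\<close> is included
    in order to obtain the next centre.\<close>
  have tail: "F x = a + jump_sign F v'" if "v + 2 * int (k + 1) \<le> x" "x \<le> v' + 1" "even (x - v)" for x
  proof -
    have "odd (x - v')" using that odd_vv' by presburger
    then have "F x = F v' + jump_sign F v'" using jump_neighbour[OF hom j(2), of x] that k by auto
    then show ?thesis using centre[of v'] odd_vv' v by auto
  qed
  define w where "w = map (\<lambda>i. F (v + 2 * int i + 2) - a) [0..<k + 1]"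
  have len: "length w = k + 1" by (simp add: w_def)
  then have ne: "w \<noteq> []" by auto
  have "set w \<subseteq> {1, -1}"
  proof
    fix x assume "x \<in> set w"
    then obtain i where i: "i < k + 1" "x = F (v + 2 * int i + 2) - a"
      by (auto simp: w_def simp del: upt_Suc)
    have "F (v + 1 + 2 * int i) = a" using centre_aux[of i] i k by auto
    moreover have "\<bar>F (v + 2 * int i + 2) - F (v + 1 + 2 * int i)\<bar> = 1"
      using hom by (auto simp: local_hom_def)
    ultimately have "\<bar>x\<bar> = 1" using i by simp
    then show "x \<in> {1, -1}" by auto
  qed
  moreover have hd: "hd w = jump_sign F v"
    using s by (simp add: w_def a_def hd_map upt_rec)
  moreover have "last w = F (v + 2 * int k + 2) - a"
    by (simp add: w_def last_map)
  then have last: "last w = jump_sign F v'"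
    using tail[of "v + 2 * int k + 2"] k by auto
  moreover have blen: "v + int (block_len d w) = v'"
    using len k by (simp add: block_len_def)
  moreover have "is_block d F v a w"
  proof (rule is_blockI)
    fix i assume "i < length w"
    then show "F (v + 2 * int i + 2) = a + w ! i" by (simp add: w_def del: upt_Suc)
  next
    fix x assume "v + 2 * int (length w) \<le> x" "x \<le> v + int (block_len d w)" "even (x - v)"
    then show "F x = a + last w" unfolding last blen len by (intro tail) auto
  qed (use centre blen in auto)
  moreover have "F (v' + 1) = a + last w"
    using tail[of "v' + 1"] odd_vv' k last by auto
  ultimately show thesis using that ne unfolding a_def by blast
qed

lemma blocks_between_switches:
  assumes "local_hom d F" "switch F v" "switch F v'" "v < v'"
  shows "\<exists>ws. linked (jump_sign F v) ws \<and> length ws = card {i\<in>{v<..v'}. switch F i} \<and>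
    v + int (total_len d ws) = v' \<and> blocks d F v (F (v + 1)) ws \<and>
    ws \<noteq> [] \<and> last (map last ws) = jump_sign F v' \<and> F (v' + 1) = F (v + 1) + sum_list (map last ws)"
  using assms(2,4)
proof (induction "nat (v' - v)" arbitrary: v rule: less_induct)
  case less
  define A where "A = {i\<in>{v<..v'}. switch F i}"
  have fA: "finite A" by (rule finite_subset[of _ "{v<..v'}"]) (auto simp: A_def)
  moreover have "v' \<in> A" using less.prems assms(3) by (auto simp: A_def)
  ultimately have A: "finite A" "A \<noteq> {}" by auto
  define u where "u = Min A"
  have "u \<in> A" using Min_in[OF A] by (simp add: u_def)
  then have u: "v < u" "u \<le> v'" "switch F u" by (auto simp: A_def)
  have none: "\<not> switch F i" if "v < i" "i < u" for i
    using Min_le[OF fA, of i] that u by (auto simp: u_def A_def)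
  obtain w where w: "w \<noteq> []" "set w \<subseteq> {1, -1}" "hd w = jump_sign F v" "last w = jump_sign F u"
    "v + int (block_len d w) = u" "is_block d F v (F (v + 1)) w" "F (u + 1) = F (v + 1) + last w"
    using block_between_switches[OF assms(1) less.prems(1) u(3,1) none] by blast
  show ?case
  proof (cases "u = v'")
    case True
    have "A = {v'}" using none True \<open>u \<in> A\<close> by (force simp: A_def)
    then have "card {i\<in>{v<..v'}. switch F i} = 1" unfolding A_def by simp
    then show ?thesis using w True by (intro exI[of _ "[w]"]) auto
  next
    case False
    then have "u < v'" using u by auto
    then obtain ws where ws: "linked (jump_sign F u) ws" "length ws = card {i\<in>{u<..v'}. switch F i}"
      "u + int (total_len d ws) = v'" "blocks d F u (F (u + 1)) ws" "ws \<noteq> []"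
      "last (map last ws) = jump_sign F v'" "F (v' + 1) = F (u + 1) + sum_list (map last ws)"
      using less.hyps[of u] u by auto
    have "A = insert u {i\<in>{u<..v'}. switch F i}" using u none by (force simp: A_def)
    moreover have "finite {i\<in>{u<..v'}. switch F i}" by (rule finite_subset[of _ "{u<..v'}"]) auto
    ultimately have "card {i\<in>{v<..v'}. switch F i} = Suc (card {i\<in>{u<..v'}. switch F i})"
      unfolding A_def by simp
    then show ?thesis using w ws by (intro exI[of _ "w # ws"]) auto
  qed
qed

section \<open>Homomorphisms with a switch at the origin\<close>

definition periodic_homs :: "nat \<Rightarrow> nat \<Rightarrow> (int \<Rightarrow> int) set" where
  "periodic_homs n d = {F. F 0 = 0 \<and> (\<forall>x. F (x + int n) = F x) \<and> local_hom d F}"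

definition num_switches :: "nat \<Rightarrow> (int \<Rightarrow> int) \<Rightarrow> nat" where
  "num_switches n F = card {i\<in>{0<..int n}. switch F i}"

text \<open>The data are cyclic: the word preceding the first one is the last one, and the centre
  returns to its initial value after one period.\<close>

definition codes :: "nat \<Rightarrow> nat \<Rightarrow> int list list set" where
  "codes n d = {ws. ws \<noteq> [] \<and> linked (last (last ws)) ws \<and> total_len d ws = n \<and>
     sum_list (map last ws) = 0}"

text \<open>As \<open>F 0 = 0\<close> and 0 is a switch, the first centre \<open>F 1\<close> is the
  sign of the jump at 0. By periodicity this is the sign of the jump at \<open>n\<close>, the last
  letter of the last word.\<close>

definition encodes :: "nat \<Rightarrow> (int \<Rightarrow> int) \<Rightarrow> int list list \<Rightarrow> bool" where
  "encodes d F ws \<longleftrightarrow> blocks d F 0 (last (last ws)) ws"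

definition partial_sums :: "int list \<Rightarrow> int set" where
  "partial_sums ts = (\<lambda>j. sum_list (take j ts)) ` {..length ts}"

lemma periodic_add_mult:
  fixes F :: "int \<Rightarrow> 'a"
  assumes "\<And>x. F (x + int n) = F x"
  shows "F (x + k * int n) = F x"
proof (induction k rule: int_induct[of _ 0])
  case (step1 i)
  then show ?case using assms[of "x + i * int n"] by (simp add: algebra_simps)
next
  case (step2 i)
  then show ?case using assms[of "x + (i - 1) * int n"] by (simp add: algebra_simps)
qed simp

lemma periodic_mod:
  fixes F :: "int \<Rightarrow> 'a"
  assumes "\<And>x. F (x + int n) = F x"
  shows "F ((x - 1) mod int n + 1) = F x"
proof -
  have "x = ((x - 1) mod int n + 1) + ((x - 1) div int n) * int n" by simp
  then show ?thesis using periodic_add_mult[of F n, OF assms] by metis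
qed

lemma mod_window:
  assumes "n > 0"
  shows "0 < (x - 1) mod int n + 1" "(x - 1) mod int n + 1 \<le> int n"
  using assms pos_mod_sign[of "int n" "x - 1"] pos_mod_bound[of "int n" "x - 1"] by linarith+

lemma switch_periodic:
  assumes "\<And>x. F (x + c) = F x"
  shows "switch F (v + c) \<longleftrightarrow> switch F v"
proof -
  have shift: "switch F v \<longleftrightarrow> switch (\<lambda>x. F (x - c)) (v + c)" for F :: "int \<Rightarrow> int" and c v
  proof -
    have j: "jump (\<lambda>x. F (x - c)) i \<longleftrightarrow> jump F (i - c)" for i
      by (simp add: jump_def algebra_simps)
    have "(\<exists>u<v. jump F u \<and> odd (v - u) \<and> (\<forall>i. u < i \<and> i < v \<longrightarrow> \<not> jump F i)) \<longleftrightarrow>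
      (\<exists>u<v + c. jump F (u - c) \<and> odd (v + c - u) \<and> (\<forall>i. u < i \<and> i < v + c \<longrightarrow> \<not> jump F (i - c)))"
      (is "?L \<longleftrightarrow> ?R")
    proof
      assume ?L
      then obtain u where u: "u < v" "jump F u" "odd (v - u)" "\<And>i. u < i \<Longrightarrow> i < v \<Longrightarrow> \<not> jump F i"
        by blast
      have "\<not> jump F (i - c)" if "u + c < i" "i < v + c" for i
        using u(4)[of "i - c"] that by auto
      then show ?R using u by (intro exI[of _ "u + c"]) auto
    next
      assume ?R
      then obtain u where u: "u < v + c" "jump F (u - c)" "odd (v + c - u)"
        "\<And>i. u < i \<Longrightarrow> i < v + c \<Longrightarrow> \<not> jump F (i - c)"
        by blast
      have "\<not> jump F i" if "u - c < i" "i < v" for i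
        using u(4)[of "i + c"] that by auto
      moreover have "v - (u - c) = v + c - u" by simp
      ultimately show ?L using u by (intro exI[of _ "u - c"]) auto
    qed
    then show ?thesis by (simp add: switch_def j)
  qed
  have "F (x - c) = F x" for x using assms[of "x - c"] by simp
  then show ?thesis using shift[of F v c] by simp
qed

lemma code_exists:
  assumes "F \<in> periodic_homs n d" "switch F 0" "n > 0"
  shows "\<exists>ws\<in>codes n d. encodes d F ws \<and> length ws = num_switches n F"
proof -
  have F: "F 0 = 0" "\<And>x. F (x + int n) = F x" "local_hom d F"
    using assms by (auto simp: periodic_homs_def)
  have "switch F (int n)" using switch_periodic[of F "int n" 0] F assms by simp
  then obtain ws where ws: "linked (jump_sign F 0) ws" "length ws = num_switches n F"
      "total_len d ws = n" "blocks d F 0 (F 1) ws" "ws \<noteq> []"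
      "last (map last ws) = jump_sign F (int n)" "F (int n + 1) = F 1 + sum_list (map last ws)"
    using blocks_between_switches[OF F(3) assms(2), of "int n"] assms(3)
    by (auto simp: num_switches_def)
  have "jump_sign F (int n) = jump_sign F 0"
    using F(2)[of 0] F(2)[of 2] by (simp add: jump_sign_def add.commute)
  moreover have "F 1 = jump_sign F 0"
    using jump_sign(3)[OF F(3), of 0] assms(2) F(1) by (simp add: switch_def)
  moreover have "F (int n + 1) = F 1" using F(2)[of 1] by (simp add: add.commute)
  ultimately show ?thesis using ws by (intro bexI[of _ ws]) (auto simp: codes_def encodes_def last_map)
qed

lemma total_len_ge:
  assumes "linked s ws" "ws \<noteq> []"
  shows "2 * d + 1 \<le> total_len d ws"
  using total_len_linked[OF assms(1), of d] assms(2) by (cases ws) auto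

lemma encoded_exists:
  assumes ws: "ws \<in> codes n d" and d: "d \<ge> 1"
  shows "\<exists>F\<in>periodic_homs n d. switch F 0 \<and> encodes d F ws"
proof -
  define s where "s = last (last ws)"
  have ws: "ws \<noteq> []" "linked s ws" "total_len d ws = n" "sum_list (map last ws) = 0"
    "last (map last ws) = s"
    using ws by (auto simp: codes_def s_def last_map)
  have n: "2 * d + 1 \<le> n" using total_len_ge[OF ws(2,1), of d] ws by simp
  \<comment> \<open>The blocks occupy the vertices 1 to \<open>n\<close>, so the representative of
    \<open>x\<close> is chosen in that range.\<close>
  define F where "F x = path_of d 0 s ws ((x - 1) mod int n + 1)" for x
  have per: "F (x + int n) = F x" for x
  proof -
    have "(x + int n - 1) mod int n = (x - 1) mod int n"
      by (metis add.commute add_diff_eq mod_add_self1)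
    then show ?thesis by (simp add: F_def)
  qed
  have B0: "blocks d F 0 s ws"
    using blocks_path_of[of d 0 s ws] blocks_cong[of 0 d ws F "path_of d 0 s ws" s] ws(3)
    by (auto simp: F_def)
  \<comment> \<open>Two copies of the code describe two periods. Pairs of vertices straddling the
    end of a period, and the switch at \<open>n\<close> itself, then lie inside one linked list of
    blocks.\<close>
  have "(\<lambda>x. F (x + int n)) = F" using per by auto
  then have "blocks d F (int n) s ws" using blocks_shift[of d F "int n" 0 s ws] B0 by simp
  then have B: "blocks d F 0 s (ws @ ws)" using B0 ws by (simp add: blocks_append)
  have L: "linked s (ws @ ws)" using ws by (simp add: linked_append)
  have F0: "F 0 = 0" using blocks_end[OF ws(2) B0 ws(1)] ws per[of 0] by simp
  have lt: "\<bar>F j - F i\<bar> = 1" if "i < j" "odd (j - i)" "j - i \<le> 2 * int d + 1" for i j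
  proof -
    define p where "p = (i - 1) mod int n + 1"
    have p: "0 < p" "p \<le> int n" unfolding p_def by (rule mod_window, use n in simp)+
    have ip: "i = p + ((i - 1) div int n) * int n" by (simp add: p_def)
    have "F i = F p" by (subst ip, rule periodic_add_mult) (rule per)
    moreover have "F j = F (p + (j - i))"
    proof -
      have "j = p + (j - i) + ((i - 1) div int n) * int n" using ip by linarith
      then show ?thesis using periodic_add_mult[of F n "p + (j - i)" "(i - 1) div int n"] per by metis
    qed
    moreover have "\<bar>F (p + (j - i)) - F p\<bar> = 1"
      by (rule linked_blocks_local_hom[OF L B]) (use p that n ws in auto)
    ultimately show ?thesis by simp
  qed
  have hom: "local_hom d F"
    unfolding local_hom_def
  proof (intro allI impI)
    fix i j :: int assume a: "odd (j - i)" "\<bar>j - i\<bar> \<le> 2 * int d + 1"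
    then consider "i < j" | "j < i" by (cases i j rule: linorder_cases) auto
    then show "\<bar>F j - F i\<bar> = 1"
      using lt[of i j] lt[of j i] a by cases (auto simp: abs_minus_commute)
  qed
  have "switch F (0 + int (total_len d ws))"
    by (rule switch_between_blocks[of s ws "hd ws" "tl ws" d F 0 s]) (use L B ws F0 d in auto)
  then have "switch F 0" using switch_periodic[of F "int n" 0] per ws by simp
  then show ?thesis using hom per F0 B0 by (auto simp: periodic_homs_def encodes_def s_def)
qed

lemma code_unique:
  assumes "encodes d F ws" "encodes d F ws'" "ws \<in> codes n d" "ws' \<in> codes n d" "d \<ge> 1"
  shows "ws = ws'"
proof -
  have first: "last (last ws) = F 1" if e: "encodes d F ws" "ws \<in> codes n d" for ws
  proof -
    have "ws \<noteq> []" using e by (simp add: codes_def)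
    then obtain w us where ws: "ws = w # us" by (cases ws) auto
    have "linked (last (last ws)) ws" using e by (simp add: codes_def)
    then have "w \<noteq> []" unfolding ws by simp
    then have "block_len d w \<ge> 1" by (cases w) (auto simp: block_len_def)
    moreover have "is_block d F 0 (last (last ws)) w" using e unfolding encodes_def by (simp add: ws)
    ultimately show ?thesis using is_block_odd[of d F 0 "last (last ws)" w 1] by simp
  qed
  show ?thesis
  proof (rule blocks_unique)
    show "blocks d F 0 (F 1) ws" "blocks d F 0 (F 1) ws'"
      using assms first[of ws] first[of ws'] by (simp_all add: encodes_def)
    show "linked (last (last ws)) ws" "linked (last (last ws')) ws'" "total_len d ws = total_len d ws'"
      using assms by (simp_all add: codes_def)
  qed fact
qed

lemma encoded_unique:
  assumes "encodes d F ws" "encodes d G ws" "ws \<in> codes n d"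
    "F \<in> periodic_homs n d" "G \<in> periodic_homs n d" "n > 0"
  shows "F = G"
proof
  fix x
  define p where "p = (x - 1) mod int n + 1"
  have p: "0 < p" "p \<le> int n" unfolding p_def by (rule mod_window[OF assms(6)])+
  have "F p = G p"
    by (rule blocks_determine[of d F 0 "last (last ws)" ws G])
      (use assms p in \<open>auto simp: codes_def encodes_def\<close>)
  then show "F x = G x"
    using periodic_mod[of F n x] periodic_mod[of G n x] assms by (auto simp: periodic_homs_def p_def)
qed

section \<open>The range of an encoded homomorphism\<close>

lemma blocks_values:
  assumes "linked s ws" "blocks d F v a ws" "d \<ge> 1"
  shows "v < x \<Longrightarrow> x \<le> v + int (total_len d ws) \<Longrightarrow>
      \<exists>j<length ws. \<bar>F x - (a + sum_list (take j (map last ws)))\<bar> \<le> 1"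
    and "j < length ws \<Longrightarrow> \<exists>x. F x = a + sum_list (take j (map last ws))"
    and "j < length ws \<Longrightarrow> \<exists>x. F x = a + sum_list (take j (map last ws)) + (s # map last ws) ! j"
proof -
  show "\<exists>j<length ws. \<bar>F x - (a + sum_list (take j (map last ws)))\<bar> \<le> 1"
    if "v < x" "x \<le> v + int (total_len d ws)"
    using assms that
  proof (induction ws arbitrary: s v a)
    case (Cons w ws)
    show ?case
    proof (cases "x \<le> v + int (block_len d w)")
      case True
      then have "F x - a \<in> {1, -1, 0}"
        using is_block_odd[of d F v a w x] is_block_even(1)[of d F v a w x] Cons.prems
        by (cases "even (x - v)") auto
      then show ?thesis by (intro exI[of _ 0]) auto
    next
      case False
      then obtain j where "j < length ws"
          "\<bar>F x - (a + last w + sum_list (take j (map last ws)))\<bar> \<le> 1"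
        using Cons.IH[of "last w" "v + int (block_len d w)" "a + last w"] Cons.prems by auto
      then show ?thesis by (intro exI[of _ "Suc j"]) (auto simp: add.assoc)
    qed
  qed simp
  show "\<exists>x. F x = a + sum_list (take j (map last ws))" if "j < length ws"
    using assms that
  proof (induction ws arbitrary: s v a j)
    case (Cons w ws)
    show ?case
    proof (cases j)
      case 0
      have "block_len d w \<ge> 1" using Cons.prems by (cases w) (auto simp: block_len_def)
      then have "F (v + 1) = a" using is_block_odd[of d F v a w "v + 1"] Cons.prems by auto
      then show ?thesis using 0 by auto
    next
      case (Suc i)
      then show ?thesis
        using Cons.IH[of "last w" "v + int (block_len d w)" "a + last w" i] Cons.prems
        by (auto simp: add.assoc)
    qed
  qed simp
  show "\<exists>x. F x = a + sum_list (take j (map last ws)) + (s # map last ws) ! j" if "j < length ws"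
    using assms that
  proof (induction ws arbitrary: s v a j)
    case (Cons w ws)
    show ?case
    proof (cases j)
      case 0
      \<comment> \<open>Offset two carries the first letter of the word, which is the last letter of
        the preceding word; hence the shifted list \<open>s # map last ws\<close> in this
        claim.\<close>
      have "block_len d w \<ge> 2" using Cons.prems by (cases w) (auto simp: block_len_def)
      then have "F (v + 2) = a + s" using is_block_even(3)[of d F v a w "v + 2"] Cons.prems by auto
      then show ?thesis using 0 by auto
    next
      case (Suc i)
      then show ?thesis
        using Cons.IH[of "last w" "v + int (block_len d w)" "a + last w" i] Cons.prems
        by (auto simp: add.assoc)
    qed
  qed simp
qed

text \<open>Discrete intermediate values between a minimiser and a maximiser; if the maximiser comes
  first, the argument is applied to the negated function.\<close>

lemma unit_step_image:
  fixes c :: "nat \<Rightarrow> int"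
  assumes "\<And>j. j < r \<Longrightarrow> \<bar>c (Suc j) - c j\<bar> \<le> 1"
  shows "c ` {..r} = {Min (c ` {..r})..Max (c ` {..r})}"
proof (intro equalityI subsetI)
  let ?C = "c ` {..r}"
  have C: "finite ?C" "?C \<noteq> {}" by auto
  fix y assume y: "y \<in> {Min ?C..Max ?C}"
  obtain i where i: "i \<le> r" "c i = Min ?C" using Min_in[OF C] by (metis atMost_iff imageE)
  obtain k where k: "k \<le> r" "c k = Max ?C" using Max_in[OF C] by (metis atMost_iff imageE)
  have "c i \<le> y" "y \<le> c k" using i k y by auto
  show "y \<in> ?C"
  proof (cases "i \<le> k")
    case True
    have "\<exists>j\<ge>i. j \<le> k \<and> c j = y"
      by (rule nat_intermed_int_val) (use True k assms \<open>c i \<le> y\<close> \<open>y \<le> c k\<close> in auto)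
    then show ?thesis using k by auto
  next
    case False
    have "\<exists>j\<ge>k. j \<le> i \<and> - c j = - y"
      by (rule nat_intermed_int_val[of k i "\<lambda>j. - c j" "- y"])
        (use False i(1) assms \<open>c i \<le> y\<close> \<open>y \<le> c k\<close> in \<open>simp_all add: abs_minus_commute\<close>)
    then show ?thesis using i by auto
  qed
qed auto

text \<open>The centres fill an interval because they move by unit steps, and every value of
  \<open>F\<close> is within one of a centre. So the range is this interval enlarged by at most one
  on each side, and both additional points turn out to be attained.\<close>

lemma card_range_encoded:
  assumes "F \<in> periodic_homs n d" "ws \<in> codes n d" "encodes d F ws" "d \<ge> 1"
  shows "card (range F) = card (partial_sums (map last ws)) + 2"
proof -
  define s where "s = last (last ws)"
  define ts where "ts = map last ws"
  define r where "r = length ws"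
  have ws: "ws \<noteq> []" "linked s ws" "total_len d ws = n" "sum_list ts = 0" "last ts = s"
    using assms by (auto simp: codes_def s_def last_map ts_def)
  have B: "blocks d F 0 s ws" using assms by (simp add: encodes_def s_def)
  have per: "\<And>x. F (x + int n) = F x" using assms by (simp add: periodic_homs_def)
  have n: "n > 0" using total_len_ge[OF ws(2,1), of d] ws by simp
  have r: "length ts = r" "r > 0" using ws by (auto simp: r_def ts_def)
  define c where "c j = s + sum_list (take j ts)" for j
  have cr: "c r = c 0" using ws r by (simp add: c_def)
  have signs: "linked s us \<Longrightarrow> set (map last us) \<subseteq> {1, -1}" for us s
    by (induction us arbitrary: s) (auto dest: word_signs(2))
  have ts: "ts ! j \<in> {1, -1}" if "j < r" for j
    using signs[OF ws(2)] that r unfolding ts_def by (metis nth_mem subsetD)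
  have step: "c (Suc j) = c j + ts ! j" if "j < r" for j
    using that r by (simp add: c_def take_Suc_conv_app_nth)
  define C where "C = c ` {..r}"
  have C: "finite C" "C \<noteq> {}" by (auto simp: C_def)
  \<comment> \<open>The walk is closed, so the index \<open>r\<close>, which has no block of its
    own, can be replaced by 0.\<close>
  have C_less: "\<exists>j<r. y = c j" if y: "y \<in> C" for y
  proof -
    obtain j where "j \<le> r" "y = c j" using y by (auto simp: C_def)
    then show ?thesis using cr r(2) by (intro exI[of _ "if j = r then 0 else j"]) simp
  qed
  have C_int: "C = {Min C..Max C}"
    unfolding C_def by (rule unit_step_image) (use step ts in fastforce)
  note vals = blocks_values[OF ws(2) B assms(4), folded ts_def]
  have into: "F x \<in> {Min C - 1..Max C + 1}" for x
  proof -
    define p where "p = (x - 1) mod int n + 1"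
    have p: "0 < p" "p \<le> int n" unfolding p_def by (rule mod_window, use n in simp)+
    then obtain j where j: "j < r" "\<bar>F p - c j\<bar> \<le> 1"
      using vals(1)[of p] ws by (auto simp: c_def r_def)
    have "c j \<in> C" using j by (auto simp: C_def)
    then have "Min C \<le> c j" "c j \<le> Max C" using C by auto
    then show ?thesis using j periodic_mod[of F n x] per by (auto simp: p_def)
  qed
  txt \<open>The step leading to a maximal centre is an up-step (cyclically), so the free vertices
    of that block take the value one above the maximum; symmetrically for the minimum.\<close>
  have prev: "\<exists>y\<in>C. c j = y + (s # ts) ! j" if "j < r" for j
  proof (cases j)
    case 0
    have "c r = c (r - 1) + ts ! (r - 1)" using step[of "r - 1"] r by simp
    moreover have "ts ! (r - 1) = s" using ws r by (metis last_conv_nth length_0_conv less_numeral_extra(3))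
    ultimately show ?thesis using 0 cr by (intro bexI[of _ "c (r - 1)"]) (auto simp: C_def)
  next
    case (Suc i)
    then show ?thesis using step[of i] that by (intro bexI[of _ "c i"]) (auto simp: C_def)
  qed
  have next_val: "\<exists>x. F x = c j + (s # ts) ! j" if "j < r" for j
    using vals(3)[of j] that by (simp add: c_def r_def)
  have sgn: "(s # ts) ! j \<in> {1, -1}" if "j < r" for j
  proof (cases j)
    case 0
    then show ?thesis using ts[of "r - 1"] ws r
      by (metis One_nat_def diff_less last_conv_nth length_0_conv less_numeral_extra(1,3) nth_Cons_0)
  qed (use ts[of "j - 1"] that in auto)
  have top: "Max C + 1 \<in> range F"
  proof -
    obtain j where j: "j < r" "Max C = c j" using C_less[OF Max_in[OF C]] by auto
    obtain y where y: "y \<in> C" "c j = y + (s # ts) ! j" using prev[OF j(1)] by auto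
    have "y \<le> Max C" using C y by auto
    then have "(s # ts) ! j = 1" using sgn[OF j(1)] y j by auto
    then show ?thesis using next_val[OF j(1)] j by (metis rangeI)
  qed
  have bot: "Min C - 1 \<in> range F"
  proof -
    obtain j where j: "j < r" "Min C = c j" using C_less[OF Min_in[OF C]] by auto
    obtain y where y: "y \<in> C" "c j = y + (s # ts) ! j" using prev[OF j(1)] by auto
    have "Min C \<le> y" using C y by auto
    then have "(s # ts) ! j = -1" using sgn[OF j(1)] y j by auto
    then show ?thesis using next_val[OF j(1)] j by (metis rangeI uminus_add_conv_diff add.commute)
  qed
  have mid: "y \<in> range F" if y: "y \<in> C" for y
  proof -
    obtain j where "j < r" "y = c j" using C_less[OF y] by auto
    then show ?thesis using vals(2)[of j] by (auto simp: c_def r_def) (metis rangeI)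
  qed
  have "range F = {Min C - 1..Max C + 1}"
  proof (intro equalityI subsetI)
    fix y assume "y \<in> {Min C - 1..Max C + 1}"
    then consider "y = Min C - 1" | "y = Max C + 1" | "y \<in> {Min C..Max C}" by fastforce
    then show "y \<in> range F" using top bot mid C_int by cases auto
  qed (use into in auto)
  moreover have "Min C \<le> Max C" using C by (meson Max_ge Min_in)
  ultimately have "card (range F) = card {Min C..Max C} + 2" by simp
  also have "card {Min C..Max C} = card C" using C_int by simp
  also have "C = (+) s ` partial_sums ts"
    by (auto simp: C_def c_def partial_sums_def image_image r)
  also have "card \<dots> = card (partial_sums ts)" by (simp add: card_image)
  finally show ?thesis by (simp add: ts_def)
qed

section \<open>Rotations and marked switches\<close>

lemma local_homD:
  "local_hom d F \<Longrightarrow> odd (j - i) \<Longrightarrow> \<bar>j - i\<bar> \<le> 2 * int d + 1 \<Longrightarrow> \<bar>F j - F i\<bar> = 1"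
  unfolding local_hom_def by blast

lemma local_hom_iff_lt:
  "local_hom d F \<longleftrightarrow> (\<forall>i j. i < j \<longrightarrow> odd (j - i) \<longrightarrow> j - i \<le> 2 * int d + 1 \<longrightarrow> \<bar>F j - F i\<bar> = 1)"
  (is "_ \<longleftrightarrow> ?R")
proof
  assume R: ?R
  show "local_hom d F"
    unfolding local_hom_def
  proof (intro allI impI)
    fix i j :: int assume a: "odd (j - i)" "\<bar>j - i\<bar> \<le> 2 * int d + 1"
    then consider "i < j" | "j < i" by (cases i j rule: linorder_cases) auto
    then show "\<bar>F j - F i\<bar> = 1"
    proof cases
      case 2
      then have "\<bar>F i - F j\<bar> = 1" using R a by auto
      then show ?thesis by simp
    qed (use R a in auto)
  qed
qed (auto simp: local_hom_def)

lemma periodic_hom_restrict: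
  assumes "F \<in> periodic_homs n d" "n > 0"
  shows "restrict (\<lambda>i. F (int i)) {0..<n} \<in> Hom_T n d"
    and "restrict (\<lambda>i. F (int i)) {0..<n} ` {0..<n} = range F"
proof -
  have F: "F 0 = 0" "\<And>x. F (x + int n) = F x" "local_hom d F"
    using assms by (auto simp: periodic_homs_def)
  have lt: "\<bar>F (int i) - F (int j)\<bar> = 1" if a: "T_adj n d i j" "i < j" for i j
  proof -
    obtain m where m: "m \<le> d" "j < n"
      "min (int j - int i) (int n - (int j - int i)) = 2 * int m + 1"
      using a by (auto simp: T_adj_def)
    then consider "int j - int i = 2 * int m + 1" | "int i + int n - int j = 2 * int m + 1"
      by (auto simp: min_def split: if_splits)
    then show ?thesis
    proof cases
      case 1
      have "odd (int j - int i)" unfolding 1 by simp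
      moreover have "\<bar>int j - int i\<bar> \<le> 2 * int d + 1" unfolding 1 using m(1) by simp
      ultimately have "\<bar>F (int j) - F (int i)\<bar> = 1" by (rule local_homD[OF F(3)])
      then show ?thesis by simp
    next
      case 2
      have "odd (int i + int n - int j)" unfolding 2 by simp
      moreover have "\<bar>int i + int n - int j\<bar> \<le> 2 * int d + 1" unfolding 2 using m(1) by simp
      ultimately have "\<bar>F (int i + int n) - F (int j)\<bar> = 1" by (rule local_homD[OF F(3)])
      then show ?thesis using F(2) by simp
    qed
  qed
  have "\<bar>F (int i) - F (int j)\<bar> = 1" if "T_adj n d i j" for i j
  proof (cases i j rule: linorder_cases)
    case equal
    then show ?thesis using that by (auto simp: T_adj_def)
  next
    case greater
    have "T_adj n d j i" using that by (auto simp: T_adj_def abs_minus_commute)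
    then show ?thesis using lt[of j i] greater by simp
  qed (use lt that in auto)
  then show "restrict (\<lambda>i. F (int i)) {0..<n} \<in> Hom_T n d"
    using F(1) assms(2) by (auto simp: Hom_T_def T_adj_def)
  show "restrict (\<lambda>i. F (int i)) {0..<n} ` {0..<n} = range F"
  proof (intro equalityI subsetI)
    fix y assume "y \<in> range F"
    then obtain x where x: "y = F x" by auto
    have "F (x mod int n) = F x"
      using periodic_add_mult[of F n "x mod int n" "x div int n"] F(2) by simp
    moreover have "nat (x mod int n) < n" "int (nat (x mod int n)) = x mod int n"
      using assms(2) by (simp_all add: nat_less_iff)
    ultimately show "y \<in> restrict (\<lambda>i. F (int i)) {0..<n} ` {0..<n}"
      using x by (intro image_eqI[of _ _ "nat (x mod int n)"]) auto
  qed auto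
qed

text \<open>Since \<open>2(2d + 1) <= n\<close>, an odd difference of at most \<open>2d + 1\<close>
  is at most half the period. It therefore equals the cyclic distance in \<open>T_adj\<close>,
  whether or not the reduction modulo \<open>n\<close> wraps around.\<close>

lemma Hom_T_extend:
  assumes "f \<in> Hom_T n d" "4 * d + 2 \<le> n"
  shows "(\<lambda>x. f (nat (x mod int n))) \<in> periodic_homs n d"
proof -
  define G where "G x = f (nat (x mod int n))" for x
  have n: "n > 0" using assms by simp
  have "\<bar>G j - G i\<bar> = 1" if a: "i < j" "odd (j - i)" "j - i \<le> 2 * int d + 1" for i j
  proof -
    define \<delta> where "\<delta> = j - i"
    obtain m where m: "\<delta> = 2 * m + 1" using a(2) unfolding \<delta>_def by (rule oddE)
    have \<delta>: "0 < \<delta>" "2 * \<delta> \<le> int n" using a assms(2) by (auto simp: \<delta>_def)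
    define p where "p = i mod int n"
    define q where "q = j mod int n"
    have p: "0 \<le> p" "p < int n" and q: "0 \<le> q" "q < int n"
      using n by (auto simp: p_def q_def)
    have "q = (p + \<delta>) mod int n" by (simp add: p_def q_def \<delta>_def mod_simps)
    moreover have "(p + \<delta>) mod int n = p + \<delta>" if "p + \<delta> < int n"
      using that p \<delta> by (intro mod_pos_pos_trivial) auto
    moreover have "(p + \<delta>) mod int n = p + \<delta> - int n" if "\<not> p + \<delta> < int n"
    proof -
      have "(p + \<delta>) mod int n = (p + \<delta> - int n) mod int n" by simp
      also have "\<dots> = p + \<delta> - int n" using that p \<delta> by (intro mod_pos_pos_trivial) auto
      finally show ?thesis .
    qed
    ultimately have "q = p + \<delta> \<or> q = p + \<delta> - int n" by auto
    then have "min \<bar>p - q\<bar> (int n - \<bar>p - q\<bar>) = \<delta>" using \<delta> p q by (auto simp: min_def)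
    then have "T_adj n d (nat p) (nat q)"
      using p q m a \<delta> by (auto simp: T_adj_def \<delta>_def intro!: exI[of _ "nat m"])
    then have "\<bar>f (nat p) - f (nat q)\<bar> = 1" using assms(1) by (auto simp: Hom_T_def)
    then show ?thesis by (simp add: G_def p_def q_def)
  qed
  then have "local_hom d G" by (auto simp: local_hom_iff_lt)
  moreover have "G 0 = 0" using assms(1) by (simp add: G_def Hom_T_def)
  ultimately show ?thesis by (simp add: periodic_homs_def G_def[abs_def])
qed

lemma bij_betw_periodic_homs:
  assumes "4 * d + 2 \<le> n"
  shows "bij_betw (\<lambda>F. restrict (\<lambda>i. F (int i)) {0..<n}) (periodic_homs n d) (Hom_T n d)"
proof (rule bij_betw_byWitness[where f' = "\<lambda>f x. f (nat (x mod int n))"])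
  have n: "n > 0" using assms by simp
  show "\<forall>F\<in>periodic_homs n d. (\<lambda>x. restrict (\<lambda>i. F (int i)) {0..<n} (nat (x mod int n))) = F"
  proof (intro ballI ext)
    fix F x assume F: "F \<in> periodic_homs n d"
    have "F (x mod int n) = F x"
      using periodic_add_mult[of F n "x mod int n" "x div int n"] F by (simp add: periodic_homs_def)
    then show "restrict (\<lambda>i. F (int i)) {0..<n} (nat (x mod int n)) = F x"
      using n by (simp add: nat_less_iff)
  qed
  show "\<forall>f\<in>Hom_T n d. (\<lambda>i\<in>{0..<n}. f (nat (int i mod int n))) = f"
  proof
    fix f assume "f \<in> Hom_T n d"
    then have "f \<in> extensional {0..<n}" by (auto simp: Hom_T_def PiE_def)
    then show "(\<lambda>i\<in>{0..<n}. f (nat (int i mod int n))) = f"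
      by (intro extensionalityI[of _ "{0..<n}"]) auto
  qed
qed (use assms periodic_hom_restrict(1)[of _ n d] Hom_T_extend[of _ n d] in auto)

lemma finite_periodic_homs: "4 * d + 2 \<le> n \<Longrightarrow> finite (periodic_homs n d)"
  using bij_betw_finite[OF bij_betw_periodic_homs] finite_Hom_T by blast

definition rotate_hom :: "int \<Rightarrow> (int \<Rightarrow> int) \<Rightarrow> int \<Rightarrow> int" where
  "rotate_hom c F x = F (x + c) - F c"

lemma rotate_hom_periodic: "F \<in> periodic_homs n d \<Longrightarrow> rotate_hom c F \<in> periodic_homs n d"
proof -
  assume F: "F \<in> periodic_homs n d"
  have "rotate_hom c F (x + int n) = rotate_hom c F x" for x
  proof -
    have "F (x + c + int n) = F (x + c)" using F by (simp add: periodic_homs_def)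
    moreover have "x + c + int n = x + int n + c" by simp
    ultimately show ?thesis by (simp add: rotate_hom_def)
  qed
  moreover have "local_hom d (rotate_hom c F)"
    unfolding local_hom_def
  proof (intro allI impI)
    fix i j :: int assume "odd (j - i)" "\<bar>j - i\<bar> \<le> 2 * int d + 1"
    then have "\<bar>F (j + c) - F (i + c)\<bar> = 1"
      using F local_homD[of d F "j + c" "i + c"] by (simp add: periodic_homs_def)
    then show "\<bar>rotate_hom c F j - rotate_hom c F i\<bar> = 1" by (simp add: rotate_hom_def)
  qed
  ultimately show ?thesis by (simp add: periodic_homs_def rotate_hom_def)
qed

lemma rotate_hom_inverse: "F 0 = 0 \<Longrightarrow> rotate_hom (- c) (rotate_hom c F) = F"
  by (auto simp: rotate_hom_def)

lemma card_range_rotate_hom: "card (range (rotate_hom c F)) = card (range F)"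
proof -
  have "range (rotate_hom c F) = (\<lambda>y. y - F c) ` F ` range (\<lambda>x. x + c)"
    by (simp only: image_image rotate_hom_def[abs_def])
  also have "range (\<lambda>x. x + c) = UNIV"
    by (rule surjI[of _ "\<lambda>x. x - c"]) simp
  finally have "range (rotate_hom c F) = (\<lambda>y. y - F c) ` range F" .
  then show ?thesis by (simp add: card_image)
qed

lemma switch_rotate_hom: "switch (rotate_hom c F) v \<longleftrightarrow> switch F (v + c)"
proof -
  have j: "jump (rotate_hom c F) i \<longleftrightarrow> jump F (i + c)" for i
    by (simp add: jump_def rotate_hom_def algebra_simps)
  show ?thesis
  proof
    assume "switch (rotate_hom c F) v"
    then obtain u where u: "jump F (v + c)" "u < v" "jump F (u + c)" "odd (v - u)"
      "\<And>i. u < i \<Longrightarrow> i < v \<Longrightarrow> \<not> jump F (i + c)"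
      by (auto simp: switch_def j)
    have "\<not> jump F i" if "u + c < i" "i < v + c" for i using u(5)[of "i - c"] that by simp
    then show "switch F (v + c)" unfolding switch_def using u by (intro conjI exI[of _ "u + c"]) auto
  next
    assume "switch F (v + c)"
    then obtain u where u: "jump F (v + c)" "u < v + c" "jump F u" "odd (v + c - u)"
      "\<And>i. u < i \<Longrightarrow> i < v + c \<Longrightarrow> \<not> jump F i"
      by (auto simp: switch_def)
    have "v - (u - c) = v + c - u" by simp
    then show "switch (rotate_hom c F) v"
      unfolding switch_def j using u by (intro conjI exI[of _ "u - c"]) auto
  qed
qed

lemma card_period_window:
  fixes P :: "int \<Rightarrow> bool"
  assumes "\<And>x. P (x + int n) = P x" "n > 0"
  shows "card {j\<in>{0<..int n}. P (j + c)} = card {j\<in>{0<..int n}. P j}"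
proof (rule bij_betw_same_card[OF bij_betw_byWitness[where
        f = "\<lambda>j. (j + c - 1) mod int n + 1" and f' = "\<lambda>j. (j - c - 1) mod int n + 1"]])
  have w: "(x - 1) mod int n + 1 = x" if "0 < x" "x \<le> int n" for x
    using that by simp
  show "\<forall>j\<in>{j \<in> {0<..int n}. P (j + c)}. ((j + c - 1) mod int n + 1 - c - 1) mod int n + 1 = j"
    using w by (auto simp: mod_simps algebra_simps)
  show "\<forall>j\<in>{j \<in> {0<..int n}. P j}. ((j - c - 1) mod int n + 1 + c - 1) mod int n + 1 = j"
    using w by (auto simp: mod_simps algebra_simps)
  have pm: "P ((x - 1) mod int n + 1) = P x" for x using periodic_mod[of P n x] assms by blast
  show "(\<lambda>j. (j + c - 1) mod int n + 1) ` {j \<in> {0<..int n}. P (j + c)} \<subseteq> {j \<in> {0<..int n}. P j}"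
    using mod_window[OF assms(2)] pm by auto
  have pm': "P ((j - c - 1) mod int n + 1 + c) = P j" for j
  proof -
    have "P ((j - c - 1) mod int n + 1 + c) = P (((j - c - 1) mod int n + 1 + c - 1) mod int n + 1)"
      by (rule pm[symmetric])
    also have "((j - c - 1) mod int n + 1 + c - 1) mod int n = (j - 1) mod int n"
      by (simp add: mod_simps algebra_simps)
    finally show ?thesis by (simp add: pm)
  qed
  show "(\<lambda>j. (j - c - 1) mod int n + 1) ` {j \<in> {0<..int n}. P j} \<subseteq> {j \<in> {0<..int n}. P (j + c)}"
    using mod_window[OF assms(2)] pm' by auto
qed

lemma num_switches_rotate_hom:
  assumes "F \<in> periodic_homs n d" "n > 0"
  shows "num_switches n (rotate_hom c F) = num_switches n F"
proof -
  have "switch F (x + int n) = switch F x" for x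
    using assms by (intro switch_periodic) (auto simp: periodic_homs_def)
  then show ?thesis
    unfolding num_switches_def switch_rotate_hom using assms by (intro card_period_window) auto
qed

text \<open>The predicate \<open>P\<close> serves two purposes: it is trivial for the upper bound on
  all homomorphisms and singles out one range size for the lower bound.\<close>

definition homs_with :: "nat \<Rightarrow> nat \<Rightarrow> nat \<Rightarrow> (nat \<Rightarrow> bool) \<Rightarrow> (int \<Rightarrow> int) set" where
  "homs_with n d r P = {F\<in>periodic_homs n d. num_switches n F = r \<and> P (card (range F))}"

text \<open>Double counting of pairs of a homomorphism and one of its switches, which is rotated to the
  origin.\<close>

lemma mark_switch:
  assumes "4 * d + 2 \<le> n"
  shows "r * card (homs_with n d r P) = n * card {F\<in>homs_with n d r P. switch F 0}"
proof -
  let ?H = "homs_with n d r P"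
  have n: "n > 0" using assms by simp
  have fin: "finite ?H" using finite_periodic_homs[OF assms] by (simp add: homs_with_def)
  have rot: "rotate_hom c F \<in> ?H" if "F \<in> ?H" for c F
    using that rotate_hom_periodic num_switches_rotate_hom[OF _ n] card_range_rotate_hom
    by (auto simp: homs_with_def)
  have "card {F\<in>?H. switch F i} = card {F\<in>?H. switch F 0}" for i
  proof (rule bij_betw_same_card[OF bij_betw_byWitness[where
          f = "rotate_hom i" and f' = "rotate_hom (- i)"]])
    show "\<forall>F\<in>{F \<in> ?H. switch F i}. rotate_hom (- i) (rotate_hom i F) = F"
      using rotate_hom_inverse[of _ i] by (auto simp: homs_with_def periodic_homs_def)
    show "\<forall>F\<in>{F \<in> ?H. switch F 0}. rotate_hom i (rotate_hom (- i) F) = F"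
      using rotate_hom_inverse[of _ "- i"] by (auto simp: homs_with_def periodic_homs_def)
  qed (use rot in \<open>auto simp: switch_rotate_hom\<close>)
  then have "(\<Sum>i\<in>{0<..int n}. card {F\<in>?H. switch F i}) =
      (\<Sum>i\<in>{0<..int n}. card {F\<in>?H. switch F 0})"
    by (intro sum.cong refl)
  also have "\<dots> = n * card {F\<in>?H. switch F 0}" by simp
  finally have "(\<Sum>i\<in>{0<..int n}. card {F\<in>?H. switch F i}) = n * card {F\<in>?H. switch F 0}" .
  moreover have "(\<Sum>i\<in>{0<..int n}. card {F\<in>?H. switch F i}) =
      (\<Sum>F\<in>?H. card {i\<in>{0<..int n}. switch F i})"
    using fin by (intro sum_multicount_gen) auto
  moreover have "(\<Sum>F\<in>?H. card {i\<in>{0<..int n}. switch F i}) = r * card ?H"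
    by (simp add: homs_with_def num_switches_def)
  ultimately show ?thesis by simp
qed

text \<open>Meant for the relation \<open>encodes d\<close>: the four hypotheses are the existence
  and uniqueness results for codes and for encoded functions.\<close>

lemma card_eq_by_relation:
  assumes "\<And>a. a \<in> A \<Longrightarrow> \<exists>b\<in>B. R a b" "\<And>b. b \<in> B \<Longrightarrow> \<exists>a\<in>A. R a b"
    and "\<And>a b b'. R a b \<Longrightarrow> R a b' \<Longrightarrow> a \<in> A \<Longrightarrow> b \<in> B \<Longrightarrow> b' \<in> B \<Longrightarrow> b = b'"
    and "\<And>a a' b. R a b \<Longrightarrow> R a' b \<Longrightarrow> a \<in> A \<Longrightarrow> a' \<in> A \<Longrightarrow> b \<in> B \<Longrightarrow> a = a'"
  shows "card A = card B"
proof -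
  obtain f where f: "\<And>a. a \<in> A \<Longrightarrow> f a \<in> B \<and> R a (f a)" using assms(1) by metis
  have "inj_on f A" using f assms(4) by (metis inj_onI)
  moreover have "f ` A = B"
  proof (intro equalityI subsetI)
    fix b assume "b \<in> B"
    then obtain a where "a \<in> A" "R a b" using assms(2) by blast
    then show "b \<in> f ` A" using f assms(3) \<open>b \<in> B\<close> by blast
  qed (use f in auto)
  ultimately show ?thesis using card_image by metis
qed

definition closed_walks :: "nat \<Rightarrow> int list set" where
  "closed_walks r = {ts. length ts = r \<and> set ts \<subseteq> {1, -1} \<and> sum_list ts = 0}"

lemma finite_closed_walks: "finite (closed_walks r)"
  by (rule finite_subset[OF _ finite_lists_length_eq[of "{1, -1 :: int}" r]])
    (auto simp: closed_walks_def)

lemma linked_signs: "linked s ws \<Longrightarrow> set (map last ws) \<subseteq> {1, -1}"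
  by (induction ws arbitrary: s) (auto dest: word_signs(2))

lemma card_marked_homs:
  assumes "d \<ge> 1" "4 * d + 2 \<le> n"
  shows "card {F\<in>homs_with n d r P. switch F 0} =
    card {ws\<in>codes n d. length ws = r \<and> P (card (partial_sums (map last ws)) + 2)}"
proof (rule card_eq_by_relation[where R = "encodes d"])
  have n: "n > 0" using assms by simp
  have len: "num_switches n F = length ws"
    if F: "F \<in> periodic_homs n d" "switch F 0" and ws: "ws \<in> codes n d" "encodes d F ws" for F ws
    using code_exists[OF F n] code_unique[of d F ws _ n] ws assms by metis
  show "\<exists>ws\<in>{ws\<in>codes n d. length ws = r \<and> P (card (partial_sums (map last ws)) + 2)}. encodes d F ws"
    if "F \<in> {F\<in>homs_with n d r P. switch F 0}" for F
  proof -
    have F: "F \<in> periodic_homs n d" "switch F 0" "num_switches n F = r" "P (card (range F))"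
      using that by (auto simp: homs_with_def)
    obtain ws where ws: "ws \<in> codes n d" "encodes d F ws" "length ws = num_switches n F"
      using code_exists[OF F(1,2) n] by auto
    then show ?thesis using card_range_encoded[OF F(1) ws(1,2) assms(1)] F by auto
  qed
  show "\<exists>F\<in>{F\<in>homs_with n d r P. switch F 0}. encodes d F ws"
    if "ws \<in> {ws\<in>codes n d. length ws = r \<and> P (card (partial_sums (map last ws)) + 2)}" for ws
  proof -
    have ws: "ws \<in> codes n d" "length ws = r" "P (card (partial_sums (map last ws)) + 2)"
      using that by auto
    obtain F where F: "F \<in> periodic_homs n d" "switch F 0" "encodes d F ws"
      using encoded_exists[OF ws(1) assms(1)] by auto
    then show ?thesis
      using card_range_encoded[OF F(1) ws(1) F(3) assms(1)] len[OF F(1,2) ws(1) F(3)] ws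
      by (auto simp: homs_with_def)
  qed
  show "ws = ws'" if "encodes d F ws" "encodes d F ws'"
    "ws \<in> {ws\<in>codes n d. length ws = r \<and> P (card (partial_sums (map last ws)) + 2)}"
    "ws' \<in> {ws\<in>codes n d. length ws = r \<and> P (card (partial_sums (map last ws)) + 2)}" for F ws ws'
    using code_unique[OF that(1,2)] that assms by auto
  show "F = G" if "encodes d F ws" "encodes d G ws"
    "F \<in> {F\<in>homs_with n d r P. switch F 0}" "G \<in> {F\<in>homs_with n d r P. switch F 0}"
    "ws \<in> {ws\<in>codes n d. length ws = r \<and> P (card (partial_sums (map last ws)) + 2)}" for F G ws
    using encoded_unique[OF that(1,2)] that n by (auto simp: homs_with_def)
qed

text \<open>The walk is cyclic, so the sign preceding the first step of \<open>ts\<close> is \<open>last ts\<close>.\<close>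

lemma codes_as_chains:
  assumes "r \<ge> 1" "n = 2 * M + r * (2 * d + 1)"
  shows "{ws\<in>codes n d. length ws = r \<and> P (map last ws)} =
    (\<Union>ts\<in>{ts\<in>closed_walks r. P ts}. chains (last ts) ts M)"
proof (intro equalityI subsetI)
  fix ws assume "ws \<in> {ws\<in>codes n d. length ws = r \<and> P (map last ws)}"
  then have ws: "ws \<noteq> []" "linked (last (last ws)) ws" "total_len d ws = n"
     "sum_list (map last ws) = 0" "length ws = r" "P (map last ws)"
    by (auto simp: codes_def)
  have "sum_list (map (\<lambda>w. length w - 1) ws) = M"
    using total_len_linked[OF ws(2), of d] ws assms by simp
  then have "ws \<in> chains (last (map last ws)) (map last ws) M"
    using ws by (simp add: mem_chains_iff last_map)
  moreover have "map last ws \<in> closed_walks r"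
    using ws linked_signs[OF ws(2)] by (simp add: closed_walks_def)
  ultimately show "ws \<in> (\<Union>ts\<in>{ts\<in>closed_walks r. P ts}. chains (last ts) ts M)"
    using ws by blast
next
  fix ws assume "ws \<in> (\<Union>ts\<in>{ts\<in>closed_walks r. P ts}. chains (last ts) ts M)"
  then obtain ts where "ts \<in> closed_walks r" "P ts" "ws \<in> chains (last ts) ts M" by blast
  then have ts: "length ts = r" "sum_list ts = 0" "P ts"
      "linked (last ts) ws" "map last ws = ts" "sum_list (map (\<lambda>w. length w - 1) ws) = M"
    by (simp_all add: mem_chains_iff closed_walks_def)
  then have "length ws = r" "ws \<noteq> []" using assms by auto
  then show "ws \<in> {ws\<in>codes n d. length ws = r \<and> P (map last ws)}"
    using ts total_len_linked[OF ts(4), of d] assms by (auto simp: codes_def last_map)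
qed

lemma card_codes_eq:
  assumes "r \<ge> 1" "n = 2 * M + r * (2 * d + 1)"
  shows "card {ws\<in>codes n d. length ws = r \<and> P (map last ws)} =
    (\<Sum>ts\<in>{ts\<in>closed_walks r. P ts}. card (chains (last ts) ts M))"
  unfolding codes_as_chains[OF assms]
  by (rule card_UN_disjoint) (auto simp: finite_closed_walks finite_chains, auto simp: mem_chains_iff)

section \<open>Counting homomorphisms by number of switches\<close>

lemma card_homs_with:
  assumes "r \<ge> 1" "d \<ge> 1" "4 * d + 2 \<le> n" "n = 2 * M + r * (2 * d + 1)"
  shows "r * card (homs_with n d r P) =
    n * (\<Sum>ts\<in>{ts\<in>closed_walks r. P (card (partial_sums ts) + 2)}. card (chains (last ts) ts M))"
  using mark_switch[OF assms(3), of r P] card_marked_homs[OF assms(2,3), of r P]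
    card_codes_eq[OF assms(1,4), of "\<lambda>ts. P (card (partial_sums ts) + 2)"]
  by simp

text \<open>The length of a code with \<open>r\<close> words has the excluded form, so no
  homomorphism of this class has a switch at the origin. As \<open>r >= 1\<close>, double counting
  of marked switches leaves none at all.\<close>

lemma homs_with_empty:
  assumes "r \<ge> 1" "d \<ge> 1" "4 * d + 2 \<le> n" "\<And>M. n \<noteq> 2 * M + r * (2 * d + 1)"
  shows "homs_with n d r P = {}"
proof -
  have "{ws\<in>codes n d. length ws = r \<and> P (card (partial_sums (map last ws)) + 2)} = {}"
    using assms(4) total_len_linked[of _ _ d] by (fastforce simp: codes_def)
  then have "card {F\<in>homs_with n d r P. switch F 0} = 0"
    unfolding card_marked_homs[OF assms(2,3)] by (simp only: card.empty)
  then have "r * card (homs_with n d r P) = 0"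
    using mark_switch[OF assms(3), of r P] by simp
  then show ?thesis
    using assms(1) finite_periodic_homs[OF assms(3)] by (simp add: homs_with_def)
qed

text \<open>A closed walk corresponds to its set of up-steps, which are \<open>m\<close> of the
  \<open>2 * m\<close> steps.\<close>

lemma card_closed_walks: "card (closed_walks (2 * m)) = (2 * m) choose m"
proof -
  let ?f = "\<lambda>S. map (\<lambda>i. if i \<in> S then 1 else (-1 :: int)) [0..<2 * m]"
  let ?g = "\<lambda>ts. {i. i < 2 * m \<and> ts ! i = (1 :: int)}"
  have sum: "sum_list (?f S) = 2 * int (card S) - 2 * int m" if "S \<subseteq> {..<2 * m}" for S
  proof -
    have "sum_list (?f S) = (\<Sum>i<2 * m. if i \<in> S then 1 else -1)"
      by (simp add: interv_sum_list_conv_sum_set_nat atLeast0LessThan del: upt_Suc)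
    also have "\<dots> = (\<Sum>i<2 * m. 2 * (if i \<in> S then 1 else 0) - 1)"
      by (intro sum.cong) auto
    also have "\<dots> = 2 * (\<Sum>i<2 * m. if i \<in> S then 1 else 0) - 2 * int m"
      by (simp add: sum_subtractf sum_distrib_left)
    also have "(\<Sum>i<2 * m. if i \<in> S then 1 else 0) = int (card ({..<2 * m} \<inter> S))"
      by (simp add: sum.If_cases)
    also have "{..<2 * m} \<inter> S = S" using that by auto
    finally show ?thesis .
  qed
  have inv: "?f (?g ts) = ts" if ts: "ts \<in> closed_walks (2 * m)" for ts
  proof (rule nth_equalityI)
    show len: "length (?f (?g ts)) = length ts" using ts by (simp add: closed_walks_def)
    fix i assume "i < length (?f (?g ts))"
    then have i: "i < 2 * m" "i < length ts" using len by simp_all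
    have "set ts \<subseteq> {1, -1}" using ts by (simp add: closed_walks_def)
    then have "ts ! i \<in> {1, -1}" using nth_mem[OF i(2)] by (rule subsetD)
    then show "?f (?g ts) ! i = ts ! i" using i(1) by auto
  qed
  have "bij_betw ?f {S. S \<subseteq> {..<2 * m} \<and> card S = m} (closed_walks (2 * m))"
  proof (rule bij_betw_byWitness[where f' = ?g])
    show "?f ` {S. S \<subseteq> {..<2 * m} \<and> card S = m} \<subseteq> closed_walks (2 * m)"
    proof
      fix ts assume "ts \<in> ?f ` {S. S \<subseteq> {..<2 * m} \<and> card S = m}"
      then obtain S where "S \<subseteq> {..<2 * m}" "card S = m" "ts = ?f S" by auto
      then show "ts \<in> closed_walks (2 * m)" using sum[of S] by (auto simp: closed_walks_def)
    qed
    show "?g ` closed_walks (2 * m) \<subseteq> {S. S \<subseteq> {..<2 * m} \<and> card S = m}"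
    proof
      fix S assume "S \<in> ?g ` closed_walks (2 * m)"
      then obtain ts where ts: "ts \<in> closed_walks (2 * m)" "S = ?g ts" by auto
      have S: "S \<subseteq> {..<2 * m}" using ts by auto
      have "?f S = ts" unfolding ts(2) by (rule inv[OF ts(1)])
      then have "int (card S) = int m" using sum[OF S] ts(1) by (simp add: closed_walks_def)
      then show "S \<in> {S. S \<subseteq> {..<2 * m} \<and> card S = m}" using S by auto
    qed
    show "\<forall>ts\<in>closed_walks (2 * m). ?f (?g ts) = ts" using inv by blast
    show "\<forall>S\<in>{S. S \<subseteq> {..<2 * m} \<and> card S = m}. ?g (?f S) = S"
      by (auto split: if_splits)
  qed
  then have "card (closed_walks (2 * m)) = card {S. S \<subseteq> {..<2 * m} \<and> card S = m}"
    by (rule bij_betw_same_card[symmetric])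
  also have "\<dots> = (2 * m) choose m" using n_subsets[of "{..<2 * m}" m] by simp
  finally show ?thesis .
qed

text \<open>The right side is the falling factorial n(n-1)...(n-k+1), and each of its factors is at
  least \<open>n - k\<close>.\<close>

lemma diff_power_le_fact_binomial: "(n - k) ^ k \<le> fact k * (n choose k)"
proof (induction k)
  case (Suc k)
  have "(n - Suc k) ^ Suc k \<le> (n - k) ^ Suc k" by (rule power_mono) auto
  also have "\<dots> \<le> (n - k) * (fact k * (n choose k))" using Suc by simp
  also have "\<dots> = fact k * ((n - k) * (n choose k))" by simp
  also have "(n - k) * (n choose k) = Suc k * (n choose Suc k)"
    by (metis binomial_absorb_comp binomial_absorption)
  finally show ?case by (simp add: algebra_simps)
qed simp

text \<open>The square of \<open>x = n 2\<^bsup>-d\<^esup>/(4 \<surd>2)\<close>.\<close>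

definition weight :: "nat \<Rightarrow> nat \<Rightarrow> real" where
  "weight n d = (real n / 2 ^ d)\<^sup>2 / 32"

text \<open>The common normal form of both bounds: \<open>n/(2m)\<close> marked rotations, \<open>2\<^sup>M\<close> sign choices and
  about \<open>(n/2)\<^bsup>2m-1\<^esup>/(2m-1)!\<close> compositions.\<close>

lemma walk_weight:
  assumes "m \<ge> 1" "h = M + m * (2 * d + 1)"
  shows "real (2 * h) * (2 ^ M * (real h ^ (2 * m - 1) / fact (2 * m - 1)) / 2 ^ (2 * m)) =
    real (2 * m) * (2 * 2 ^ h * weight (2 * h) d ^ m / fact (2 * m))"
proof -
  obtain k where k: "2 * m = Suc k" using assms by (cases m) auto
  have h: "h = M + (m + m * (2 * d))" using assms(2) by simp
  have p: "(2::real) ^ h = 2 ^ M * (2 ^ m * (2 ^ m) ^ (2 * d))"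
    by (simp only: h power_add power_mult)
  have w: "weight (2 * h) d ^ m = real h ^ (2 * m) / ((2 ^ m) ^ (2 * d) * 2 ^ m * 2 ^ (2 * m))"
  proof -
    have "weight (2 * h) d = (real h)\<^sup>2 / (2 ^ (2 * d) * 2 * 2 ^ 2)"
      by (simp add: weight_def power_divide power_mult_distrib power_even_eq)
    then have "weight (2 * h) d ^ m = (real h ^ 2) ^ m / ((2 ^ (2 * d)) ^ m * 2 ^ m * (2 ^ 2) ^ m)"
      by (simp only: power_divide power_mult_distrib)
    moreover have "((2::real) ^ (2 * d)) ^ m = (2 ^ m) ^ (2 * d)"
      by (metis power_mult mult.commute)
    ultimately show ?thesis by (simp only: power_mult[symmetric])
  qed
  have hp: "real h ^ (2 * m) = real h * real h ^ (2 * m - 1)" by (simp add: k)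
  have f: "fact (2 * m) = real (2 * m) * fact (2 * m - 1)" by (simp add: k)
  \<comment> \<open>Here \<open>A\<close>, \<open>B\<close>, \<open>C\<close>, \<open>D\<close>
    stand for 2^M, 2^m, 2^(2dm), 2^(2m), so that only a rational identity has to be checked.\<close>
  have alg: "2 * x * (A * (H / f) / D) = y * (2 * (A * (B * C)) * (x * H / (C * B * D)) / (y * f))"
    if "A \<noteq> 0" "B \<noteq> 0" "C \<noteq> 0" "D \<noteq> 0" "f \<noteq> 0" "y \<noteq> 0" for x y A B C D H f :: real
    using that by (simp add: field_simps)
  have "2 * real h * (2 ^ M * (real h ^ (2 * m - 1) / fact (2 * m - 1)) / 2 ^ (2 * m)) =
    real (2 * m) * (2 * 2 ^ h * weight (2 * h) d ^ m / fact (2 * m))"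
    unfolding p w hp f by (rule alg) (use assms(1) in auto)
  then show ?thesis by simp
qed

lemma closed_walk_signs:
  assumes "ts \<in> closed_walks r" "r \<ge> 1"
  shows "last ts \<in> {1, -1}" "set ts \<subseteq> {1, -1}" "length ts = r" "ts \<noteq> []"
proof -
  show ts: "set ts \<subseteq> {1, -1}" "length ts = r" "ts \<noteq> []" using assms by (auto simp: closed_walks_def)
  show "last ts \<in> {1, -1}" by (rule word_signs(2)[OF ts(3,1)])
qed

text \<open>Every closed walk gets the same bound, from (N choose k) <= N^k / k!. The number (2m
  choose m) of walks turns 1/(2m)! into 1/(m!)^2. When \<open>h\<close> leaves no room for
  \<open>2 * m\<close> blocks the class is empty.\<close>

lemma card_homs_with_upper:
  assumes "m \<ge> 1" "d \<ge> 2" "4 * d + 2 \<le> n" "n = 2 * h"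
  shows "real (card (homs_with n d (2 * m) (\<lambda>_. True))) \<le> 2 * 2 ^ h * weight n d ^ m / (fact m)\<^sup>2"
proof (cases "m * (2 * d + 1) \<le> h")
  case True
  define M where "M = h - m * (2 * d + 1)"
  have h: "h = M + m * (2 * d + 1)" using True by (simp add: M_def)
  have n: "n = 2 * M + 2 * m * (2 * d + 1)" using h assms by simp
  \<comment> \<open>Here \<open>d >= 2\<close> enters: \<open>4 <= 2d + 1\<close> makes the length
    \<open>m(2d + 1)\<close> removed from \<open>h\<close> pay for the shift of the upper index in
    \<open>card_chains_upper\<close>.\<close>
  have mono: "M + 2 * (2 * m) \<le> h" using assms(2) mult_le_mono2[of 4 "2 * d + 1" m] h by simp
  have "real (card (chains (last ts) ts M)) \<le> 2 ^ M * (real h ^ (2 * m - 1) / fact (2 * m - 1)) / 2 ^ (2 * m)"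
    if ts: "ts \<in> closed_walks (2 * m)" for ts
  proof -
    have "2 ^ (2 * m) * card (chains (last ts) ts M) \<le> 2 ^ M * ((M + 2 * (2 * m)) choose (2 * m - 1))"
      using card_chains_upper[of "last ts" ts M] closed_walk_signs[OF ts] assms(1) by auto
    then have "real (2 ^ (2 * m) * card (chains (last ts) ts M))
        \<le> real (2 ^ M * ((M + 2 * (2 * m)) choose (2 * m - 1)))"
      using of_nat_le_iff by blast
    moreover have "real ((M + 2 * (2 * m)) choose (2 * m - 1)) \<le> real h ^ (2 * m - 1) / fact (2 * m - 1)"
    proof -
      have "((M + 2 * (2 * m)) choose (2 * m - 1)) * fact (2 * m - 1) \<le> h ^ (2 * m - 1)"
        using binomial_fact_pow[of "M + 2 * (2 * m)" "2 * m - 1"] power_mono[OF mono, of "2 * m - 1"]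
        by simp
      then have "real (((M + 2 * (2 * m)) choose (2 * m - 1)) * fact (2 * m - 1)) \<le> real (h ^ (2 * m - 1))"
        using of_nat_le_iff by blast
      then show ?thesis by (simp add: pos_le_divide_eq)
    qed
    then have "2 ^ M * real ((M + 2 * (2 * m)) choose (2 * m - 1))
        \<le> 2 ^ M * (real h ^ (2 * m - 1) / fact (2 * m - 1))"
      by (rule mult_left_mono) simp
    ultimately have "2 ^ (2 * m) * real (card (chains (last ts) ts M))
        \<le> 2 ^ M * (real h ^ (2 * m - 1) / fact (2 * m - 1))"
      unfolding of_nat_mult of_nat_power of_nat_numeral by (rule order_trans)
    then show ?thesis by (subst pos_le_divide_eq, simp, subst mult.commute)
  qed
  then have "(\<Sum>ts\<in>closed_walks (2 * m). real (card (chains (last ts) ts M))) \<le>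
      real (card (closed_walks (2 * m))) *
        (2 ^ M * (real h ^ (2 * m - 1) / fact (2 * m - 1)) / 2 ^ (2 * m))"
    by (rule sum_bounded_above)
  then have "real n * (\<Sum>ts\<in>closed_walks (2 * m). real (card (chains (last ts) ts M))) \<le>
      real n * (real (card (closed_walks (2 * m))) *
        (2 ^ M * (real h ^ (2 * m - 1) / fact (2 * m - 1)) / 2 ^ (2 * m)))"
    by (rule mult_left_mono) simp
  also have "\<dots> = real ((2 * m) choose m) *
        (real (2 * h) * (2 ^ M * (real h ^ (2 * m - 1) / fact (2 * m - 1)) / 2 ^ (2 * m)))"
    unfolding card_closed_walks assms(4) by (rule mult.left_commute)
  also have "\<dots> = real (2 * m) * (real ((2 * m) choose m) * (2 * 2 ^ h * weight n d ^ m / fact (2 * m)))"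
    unfolding walk_weight[OF assms(1) h] assms(4) by simp
  also have "real n * (\<Sum>ts\<in>closed_walks (2 * m). real (card (chains (last ts) ts M))) =
      real (2 * m) * real (card (homs_with n d (2 * m) (\<lambda>_. True)))"
    using card_homs_with[of "2 * m" d n M "\<lambda>_. True", OF _ _ assms(3) n] assms(1,2)
    by (simp flip: of_nat_mult of_nat_sum)
  finally have "real (card (homs_with n d (2 * m) (\<lambda>_. True))) \<le>
      real ((2 * m) choose m) * (2 * 2 ^ h * weight n d ^ m / fact (2 * m))"
    by (rule mult_left_le_imp_le) (use assms(1) in simp)
  also have "real ((2 * m) choose m) = fact (2 * m) / (fact m)\<^sup>2"
    using binomial_fact[of m "2 * m", where ?'a = real] by (simp add: power2_eq_square)
  finally show ?thesis by simp
next
  case False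
  have "homs_with n d (2 * m) (\<lambda>_. True) = {}"
    by (rule homs_with_empty) (use assms False in auto)
  then show ?thesis by (simp add: weight_def)
qed

text \<open>The binomial in \<open>card_chains_lower\<close> is at least (M-2m)^(2m-1) / (2m-1)!,
  where \<open>M - 2m = h - m(2d + 3)\<close>. Replacing this base by \<open>h\<close> costs the
  last factor, which tends to one when d/n tends to zero.\<close>

lemma card_homs_with_lower:
  assumes "m \<ge> 1" "d \<ge> 1" "4 * d + 2 \<le> n" "n = 2 * h" "m * (2 * d + 3) < h"
  shows "2 * 2 ^ h * (real (card {ts\<in>closed_walks (2 * m). P (card (partial_sums ts) + 2)}) *
      weight n d ^ m / fact (2 * m) * (1 - real (m * (2 * d + 3)) / real h) ^ (2 * m - 1))
    \<le> real (card (homs_with n d (2 * m) P))"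
proof -
  let ?A = "{ts\<in>closed_walks (2 * m). P (card (partial_sums ts) + 2)}"
  define M where "M = h - m * (2 * d + 1)"
  have M: "2 * m < M" "h = M + m * (2 * d + 1)" using assms(5) by (simp_all add: M_def algebra_simps)
  then have n: "n = 2 * M + 2 * m * (2 * d + 1)" using assms by simp
  let ?q = "(1 - real (m * (2 * d + 3)) / real h) ^ (2 * m - 1)"
  have q: "?q * real h ^ (2 * m - 1) = real (M - 2 * m) ^ (2 * m - 1)"
  proof -
    have "(1 - real (m * (2 * d + 3)) / real h) * real h = real h - real (m * (2 * d + 3))"
      using assms(5) by (simp add: left_diff_distrib)
    also have "\<dots> = real (M - 2 * m)" using M by (simp add: of_nat_diff algebra_simps)
    finally show ?thesis by (metis power_mult_distrib)
  qed
  have "2 ^ M * (real h ^ (2 * m - 1) / fact (2 * m - 1)) / 2 ^ (2 * m) * ?q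
      \<le> real (card (chains (last ts) ts M))" if ts: "ts \<in> ?A" for ts
  proof -
    have "2 ^ M * ((M - 1) choose (2 * m - 1)) \<le> 2 ^ (2 * m) * card (chains (last ts) ts M)"
      using card_chains_lower[of "last ts" ts M] closed_walk_signs[of ts "2 * m"] ts assms(1) M by auto
    then have "real (2 ^ M * ((M - 1) choose (2 * m - 1))) \<le> real (2 ^ (2 * m) * card (chains (last ts) ts M))"
      using of_nat_le_iff by blast
    moreover have "real (M - 2 * m) ^ (2 * m - 1) / fact (2 * m - 1) \<le> real ((M - 1) choose (2 * m - 1))"
    proof -
      have "M - 1 - (2 * m - 1) = M - 2 * m" using assms(1) by simp
      then have "(M - 2 * m) ^ (2 * m - 1) \<le> fact (2 * m - 1) * ((M - 1) choose (2 * m - 1))"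
        using diff_power_le_fact_binomial[of "M - 1" "2 * m - 1"] by simp
      then have "real ((M - 2 * m) ^ (2 * m - 1)) \<le> real (fact (2 * m - 1) * ((M - 1) choose (2 * m - 1)))"
        using of_nat_le_iff by blast
      then show ?thesis by (simp add: pos_divide_le_eq mult.commute)
    qed
    then have "2 ^ M * (real (M - 2 * m) ^ (2 * m - 1) / fact (2 * m - 1))
        \<le> 2 ^ M * real ((M - 1) choose (2 * m - 1))"
      by (rule mult_left_mono) simp
    ultimately have "2 ^ M * (real (M - 2 * m) ^ (2 * m - 1) / fact (2 * m - 1))
        \<le> 2 ^ (2 * m) * real (card (chains (last ts) ts M))"
      unfolding of_nat_mult of_nat_power of_nat_numeral by (meson order_trans)
    then have "2 ^ M * (real (M - 2 * m) ^ (2 * m - 1) / fact (2 * m - 1)) / 2 ^ (2 * m)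
        \<le> real (card (chains (last ts) ts M))"
      by (subst pos_divide_le_eq, simp, subst mult.commute)
    then show ?thesis unfolding q[symmetric] by (simp add: mult_ac)
  qed
  then have "real (card ?A) * (2 ^ M * (real h ^ (2 * m - 1) / fact (2 * m - 1)) / 2 ^ (2 * m) * ?q) \<le>
      (\<Sum>ts\<in>?A. real (card (chains (last ts) ts M)))"
    by (rule sum_bounded_below)
  then have "real n * (real (card ?A) *
      (2 ^ M * (real h ^ (2 * m - 1) / fact (2 * m - 1)) / 2 ^ (2 * m) * ?q))
      \<le> real n * (\<Sum>ts\<in>?A. real (card (chains (last ts) ts M)))"
    by (rule mult_left_mono) simp
  also have "real n * (real (card ?A) *
      (2 ^ M * (real h ^ (2 * m - 1) / fact (2 * m - 1)) / 2 ^ (2 * m) * ?q)) =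
      real (card ?A) * ?q *
      (real (2 * h) * (2 ^ M * (real h ^ (2 * m - 1) / fact (2 * m - 1)) / 2 ^ (2 * m)))"
    unfolding assms(4) by (simp only: mult_ac)
  also have "real n * (\<Sum>ts\<in>?A. real (card (chains (last ts) ts M))) =
      real (2 * m) * real (card (homs_with n d (2 * m) P))"
    using card_homs_with[of "2 * m" d n M P, OF _ _ assms(3) n] assms(1,2)
    by (simp flip: of_nat_mult of_nat_sum)
  finally have "real (2 * m) * (real (card ?A) * ?q * (2 * 2 ^ h * weight n d ^ m / fact (2 * m)))
      \<le> real (2 * m) * real (card (homs_with n d (2 * m) P))"
    unfolding walk_weight[OF assms(1) M(2)] assms(4) by (simp add: mult_ac)
  then have "real (card ?A) * ?q * (2 * 2 ^ h * weight n d ^ m / fact (2 * m))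
      \<le> real (card (homs_with n d (2 * m) P))"
    by (rule mult_left_le_imp_le) (use assms(1) in simp)
  then show ?thesis by (simp add: mult_ac)
qed

section \<open>Homomorphisms without switches and the total count\<close>

definition even_flat :: "nat \<Rightarrow> nat \<Rightarrow> (int \<Rightarrow> int) set" where
  "even_flat n d = {F\<in>periodic_homs n d. \<forall>x. F (2 * x) = 0}"

definition odd_flat :: "nat \<Rightarrow> nat \<Rightarrow> (int \<Rightarrow> int) set" where
  "odd_flat n d = {F\<in>periodic_homs n d. \<forall>x. F (2 * x + 1) = F 1}"

lemma even_flatD: "F \<in> even_flat n d \<Longrightarrow> even x \<Longrightarrow> F x = 0"
  by (auto simp: even_flat_def elim!: evenE)

lemma odd_flatD: "F \<in> odd_flat n d \<Longrightarrow> odd x \<Longrightarrow> F x = F 1"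
  by (auto simp: odd_flat_def elim!: oddE)

text \<open>Without switches all jumps have the same parity, so the other parity class is constant.
  Conversely, a switch needs jumps in both classes.\<close>

lemma no_switch_flat:
  assumes "F \<in> periodic_homs n d" "n > 0"
  shows "num_switches n F = 0 \<longleftrightarrow> F \<in> even_flat n d \<union> odd_flat n d"
proof
  assume z: "num_switches n F = 0"
  have F: "F 0 = 0" "\<And>x. F (x + int n) = F x" using assms by (auto simp: periodic_homs_def)
  have "finite {i\<in>{0<..int n}. switch F i}" by (rule finite_subset[of _ "{0<..int n}"]) auto
  then have none: "\<not> switch F i" if "0 < i" "i \<le> int n" for i
    using z that by (auto simp: num_switches_def)
  have per: "switch F (x + int n) = switch F x" for x
    by (rule switch_periodic) (rule F)
  have no: "\<not> switch F x" for x
    using none[of "(x - 1) mod int n + 1"] mod_window[OF assms(2), of x]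
      periodic_mod[of "switch F" n x, OF per] by simp
  have same: "even (v - u)" if "jump F u" "jump F v" for u v
  proof (rule ccontr)
    assume o: "odd (v - u)"
    then consider "u < v" | "v < u" by (cases u v rule: linorder_cases) auto
    then show False
    proof cases
      case 1
      show ?thesis using switch_if_odd_jump[OF that 1 o] no by blast
    next
      case 2
      have "odd (u - v)" using o by presburger
      then show ?thesis using switch_if_odd_jump[OF that(2,1) 2] no by blast
    qed
  qed
  have flat: "F (2 * x + c) = F c" if "\<And>y. \<not> jump F (2 * y + c)" for c x
  proof (induction x rule: int_induct[of _ 0])
    case (step1 i)
    have "2 * (i + 1) + c = 2 * i + c + 2" by simp
    then show ?case using step1 that[of i] unfolding jump_def by metis
  next
    case (step2 i)
    have "2 * (i - 1) + c + 2 = 2 * i + c" by simp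
    then show ?case using step2 that[of "i - 1"] unfolding jump_def by metis
  qed simp
  show "F \<in> even_flat n d \<union> odd_flat n d"
  proof (cases "\<exists>y. jump F (2 * y)")
    case True
    then obtain y where y: "jump F (2 * y)" ..
    have "\<not> jump F (2 * x + 1)" for x using same[OF y, of "2 * x + 1"] by auto
    then show ?thesis using flat[of 1] assms by (simp add: odd_flat_def)
  next
    case False
    then have "F (2 * x) = 0" for x using flat[of 0 x] F by simp
    then show ?thesis using assms by (simp add: even_flat_def)
  qed
next
  assume fl: "F \<in> even_flat n d \<union> odd_flat n d"
  have "\<not> switch F v" for v
  proof
    assume "switch F v"
    then obtain u where uv: "jump F u" "jump F v" "odd (v - u)" by (auto simp: switch_def)
    have e: "\<not> jump F x" if "F \<in> even_flat n d" "even x" for x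
      using even_flatD[OF that(1), of x] even_flatD[OF that(1), of "x + 2"] that(2)
      by (simp add: jump_def)
    have o: "\<not> jump F x" if "F \<in> odd_flat n d" "odd x" for x
      using odd_flatD[OF that(1), of x] odd_flatD[OF that(1), of "x + 2"] that(2)
      by (simp add: jump_def)
    show False
    proof (cases "F \<in> even_flat n d")
      case True
      then show ?thesis using e[OF True, of u] e[OF True, of v] uv by auto
    next
      case False
      then have "F \<in> odd_flat n d" using fl by simp
      then show ?thesis using o[of u] o[of v] uv by auto
    qed
  qed
  then show "num_switches n F = 0" by (simp add: num_switches_def)
qed

text \<open>The \<open>h\<close> odd vertices of a period carry independent signs, recorded by the
  subset of those with sign 1.\<close>

lemma card_even_flat:
  assumes "n = 2 * h" "h > 0"
  shows "card (even_flat n d) = 2 ^ h"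
proof -
  let ?f = "\<lambda>S x. if even x then 0 else if nat ((x div 2) mod int h) \<in> S then 1 else (-1 :: int)"
  let ?g = "\<lambda>F. {i. i < h \<and> F (2 * int i + 1) = (1 :: int)}"
  have abs1: "\<bar>F (2 * x + 1)\<bar> = 1" if "F \<in> even_flat n d" for F x
  proof -
    have "local_hom d F" "F (2 * x) = 0" using that by (auto simp: even_flat_def periodic_homs_def)
    then show ?thesis using local_homD[of d F "2 * x + 1" "2 * x"] by simp
  qed
  have "bij_betw ?g (even_flat n d) (Pow {..<h})"
  proof (rule bij_betw_byWitness[where f' = ?f])
    show "\<forall>F\<in>even_flat n d. ?f (?g F) = F"
    proof (intro ballI ext)
      fix F x assume F: "F \<in> even_flat n d"
      show "?f (?g F) x = F x"
      proof (cases "even x")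
        case True
        then show ?thesis using F by (auto simp: even_flat_def elim!: evenE)
      next
        case False
        then obtain y where y: "x = 2 * y + 1" by (rule oddE)
        have "x = 2 * (y mod int h) + 1 + (y div int h) * int n"
          unfolding y assms(1) minus_div_mult_eq_mod[symmetric] by (simp add: algebra_simps)
        moreover have "F (2 * (y mod int h) + 1 + (y div int h) * int n) = F (2 * (y mod int h) + 1)"
          by (rule periodic_add_mult) (use F in \<open>auto simp: even_flat_def periodic_homs_def\<close>)
        ultimately have Fx: "F x = F (2 * (y mod int h) + 1)" by simp
        have "F x \<in> {1, -1}" using abs1[OF F, of y] y by auto
        then show ?thesis using y Fx assms by (auto simp: nat_less_iff)
      qed
    qed
    show "\<forall>S\<in>Pow {..<h}. ?g (?f S) = S" by (auto simp: mod_pos_pos_trivial split: if_splits)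
    show "?f ` Pow {..<h} \<subseteq> even_flat n d"
    proof
      fix F assume "F \<in> ?f ` Pow {..<h}"
      then obtain S where F: "F = ?f S" by auto
      have "F (x + int n) = F x" for x
      proof -
        have "(x + int n) div 2 mod int h = x div 2 mod int h" by (simp add: assms(1))
        then show ?thesis by (simp add: F assms(1))
      qed
      moreover have "local_hom d F" by (auto simp: local_hom_def F)
      ultimately show "F \<in> even_flat n d" by (auto simp: even_flat_def periodic_homs_def F)
    qed
  qed auto
  then show ?thesis using bij_betw_same_card[of ?g] by (simp add: card_Pow)
qed

lemma rotate_even_flat: "F \<in> even_flat n d \<Longrightarrow> rotate_hom 1 F \<in> odd_flat n d"
proof -
  assume F: "F \<in> even_flat n d"
  have "F (2 * x + 1 + 1) = 0" for x by (rule even_flatD[OF F]) simp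
  then have "rotate_hom 1 F (2 * x + 1) = rotate_hom 1 F 1" for x
    by (metis rotate_hom_def mult_zero_right add_0)
  then show ?thesis using F rotate_hom_periodic[of F n d 1] by (simp add: even_flat_def odd_flat_def)
qed

lemma rotate_odd_flat: "F \<in> odd_flat n d \<Longrightarrow> rotate_hom (-1) F \<in> even_flat n d"
proof -
  assume F: "F \<in> odd_flat n d"
  have "F (2 * x + (-1)) = F 1" for x by (rule odd_flatD[OF F]) simp
  then have "rotate_hom (-1) F (2 * x) = 0" for x
    by (metis rotate_hom_def mult_zero_right add_0 diff_self)
  then show ?thesis using F rotate_hom_periodic[of F n d "-1"] by (simp add: even_flat_def odd_flat_def)
qed

lemma card_odd_flat: "card (odd_flat n d) = card (even_flat n d)"
proof (rule bij_betw_same_card[symmetric, OF bij_betw_byWitness[where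
        f = "rotate_hom 1" and f' = "rotate_hom (-1)"]])
  show "\<forall>F\<in>even_flat n d. rotate_hom (-1) (rotate_hom 1 F) = F"
    using rotate_hom_inverse[of _ 1] by (auto simp: even_flat_def periodic_homs_def)
  show "\<forall>F\<in>odd_flat n d. rotate_hom 1 (rotate_hom (-1) F) = F"
    using rotate_hom_inverse[of _ "-1"] by (auto simp: odd_flat_def periodic_homs_def)
qed (use rotate_even_flat rotate_odd_flat in auto)

lemma card_even_odd_flat: "card (even_flat n d \<inter> odd_flat n d) \<le> 2"
proof -
  let ?I = "even_flat n d \<inter> odd_flat n d"
  have "inj_on (\<lambda>F. F 1) ?I"
  proof (rule inj_onI, rule ext)
    fix F G x assume FG: "F \<in> ?I" "G \<in> ?I" "F 1 = G 1"
    show "F x = G x"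
    proof (cases "even x")
      case True
      then show ?thesis using FG by (auto simp: even_flat_def elim!: evenE)
    next
      case False
      then obtain y where "x = 2 * y + 1" by (rule oddE)
      then show ?thesis using FG by (auto simp: odd_flat_def)
    qed
  qed
  moreover have "(\<lambda>F. F 1) ` ?I \<subseteq> {1, -1}"
  proof
    fix y assume "y \<in> (\<lambda>F. F 1) ` ?I"
    then obtain F where F: "F \<in> ?I" "y = F 1" by auto
    then have "local_hom d F" "F 0 = 0" by (auto simp: even_flat_def periodic_homs_def)
    then have "\<bar>y\<bar> = 1" using local_homD[of d F 1 0] F by simp
    then show "y \<in> {1, -1}" by auto
  qed
  ultimately have "card ?I \<le> card {1, -1 :: int}" by (rule card_inj_on_le) auto
  then show ?thesis by simp
qed

text \<open>If both 1 and -1 occur at odd vertices, the range is {0, 1, -1}. Any other size makes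
  the odd vertices constant as well.\<close>

lemma even_flat_range:
  assumes "F \<in> even_flat n d" "card (range F) \<noteq> 3"
  shows "F \<in> odd_flat n d"
proof (rule ccontr)
  assume "F \<notin> odd_flat n d"
  then obtain y where y: "F (2 * y + 1) \<noteq> F 1" using assms by (auto simp: odd_flat_def even_flat_def)
  have F: "local_hom d F" "\<And>x. F (2 * x) = 0" using assms by (auto simp: even_flat_def periodic_homs_def)
  have abs1: "\<bar>F (2 * x + 1)\<bar> = 1" for x
    using local_homD[OF F(1), of "2 * x + 1" "2 * x"] F(2) by simp
  have "F x \<in> {0, 1, -1}" for x
  proof (cases "even x")
    case True
    then show ?thesis using F by (auto elim!: evenE)
  next
    case False
    then obtain z where z: "x = 2 * z + 1" by (rule oddE)
    show ?thesis using abs1[of z] z by auto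
  qed
  moreover have "{0, 1, -1} \<subseteq> range F"
  proof -
    have "{F 1, F (2 * y + 1)} = {1, -1}" using abs1[of 0] abs1[of y] y by auto
    moreover have "F 0 = 0" using F(2)[of 0] by simp
    ultimately show ?thesis by (metis insert_subset rangeI empty_subsetI)
  qed
  ultimately have "range F = {0, 1, -1}" by blast
  then show False using assms(2) by simp
qed

lemma odd_flat_range:
  assumes "F \<in> odd_flat n d" "card (range F) \<noteq> 3"
  shows "F \<in> even_flat n d"
proof -
  have "rotate_hom (-1) F \<in> odd_flat n d"
    by (rule even_flat_range[OF rotate_odd_flat[OF assms(1)]]) (use assms in \<open>simp add: card_range_rotate_hom\<close>)
  then have r: "rotate_hom (-1) F (2 * x + 1) = rotate_hom (-1) F 1" for x
    by (auto simp: odd_flat_def)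
  have F0: "F 0 = 0" using assms by (simp add: odd_flat_def periodic_homs_def)
  have "F (2 * x) = 0" for x using r[of x] F0 by (simp add: rotate_hom_def)
  then show ?thesis using assms by (simp add: even_flat_def odd_flat_def)
qed

text \<open>Each flat family has \<open>2 ^ h\<close> members, and they share at most two. Members
  of only one family have a range of size 3. The intersection is lost twice, once in the size of the
  union and once as possible exceptions, whence the 4.\<close>

lemma homs_without_switch:
  assumes "4 * d + 2 \<le> n" "n = 2 * h"
  shows "card (homs_with n d 0 P) \<le> 2 * 2 ^ h"
    and "2 * 2 ^ h \<le> card (homs_with n d 0 (\<lambda>z. z = 3)) + 4"
proof -
  let ?E = "even_flat n d" and ?O = "odd_flat n d"
  have h: "h > 0" "n > 0" using assms by auto
  have fin: "finite (periodic_homs n d)" by (rule finite_periodic_homs[OF assms(1)])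
  have sub: "?E \<subseteq> periodic_homs n d" "?O \<subseteq> periodic_homs n d"
    by (auto simp: even_flat_def odd_flat_def)
  then have f: "finite ?E" "finite ?O" using fin finite_subset by blast+
  have eq: "homs_with n d 0 P = {F\<in>?E \<union> ?O. P (card (range F))}" for P
    using no_switch_flat[OF _ h(2)] sub by (auto simp: homs_with_def)
  have c: "card ?E + card ?O = 2 * 2 ^ h"
    using card_even_flat[OF assms(2) h(1)] card_odd_flat[of n d] by simp
  have "card (homs_with n d 0 P) \<le> card (?E \<union> ?O)"
    unfolding eq by (rule card_mono) (use f in auto)
  also have "\<dots> \<le> card ?E + card ?O" by (rule card_Un_le)
  finally show "card (homs_with n d 0 P) \<le> 2 * 2 ^ h" using c by simp
  have "?E \<union> ?O \<subseteq> homs_with n d 0 (\<lambda>z. z = 3) \<union> (?E \<inter> ?O)"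
    unfolding eq using even_flat_range odd_flat_range by blast
  then have "card (?E \<union> ?O) \<le> card (homs_with n d 0 (\<lambda>z. z = 3) \<union> (?E \<inter> ?O))"
    by (rule card_mono[rotated]) (use f eq in auto)
  also have "\<dots> \<le> card (homs_with n d 0 (\<lambda>z. z = 3)) + card (?E \<inter> ?O)" by (rule card_Un_le)
  finally show "2 * 2 ^ h \<le> card (homs_with n d 0 (\<lambda>z. z = 3)) + 4"
    using card_Un_Int[OF f] c card_even_odd_flat[of n d] by linarith
qed

text \<open>The relation \<open>n = 2M + r(2d + 1)\<close> and the evenness of \<open>n\<close>
  force an even number \<open>r\<close> of switches. The range \<open>m <= n\<close> is crude, from
  at most \<open>n\<close> switches in a period.\<close>

lemma card_periodic_homs_upper:
  assumes "d \<ge> 2" "4 * d + 2 \<le> n" "n = 2 * h"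
  shows "real (card (periodic_homs n d)) \<le> 2 * 2 ^ h * (\<Sum>m\<le>n. weight n d ^ m / (fact m)\<^sup>2)"
proof -
  have "periodic_homs n d \<subseteq> (\<Union>m\<in>{..n}. homs_with n d (2 * m) (\<lambda>_. True))"
  proof
    fix F assume F: "F \<in> periodic_homs n d"
    let ?r = "num_switches n F"
    have "?r \<le> card {0<..int n}" unfolding num_switches_def by (rule card_mono) auto
    then have le: "?r \<le> n" by simp
    have "even ?r"
    proof (rule ccontr)
      assume o: "odd ?r"
      have "n \<noteq> 2 * M + ?r * (2 * d + 1)" for M
      proof
        assume "n = 2 * M + ?r * (2 * d + 1)"
        then have "even (?r * (2 * d + 1))" using assms(3) by (metis dvd_triv_left even_add)
        then show False using o by simp
      qed
      then have "homs_with n d ?r (\<lambda>_. True) = {}"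
        using o assms by (intro homs_with_empty) (auto simp: Suc_le_eq intro: odd_pos)
      then show False using F by (auto simp: homs_with_def)
    qed
    then obtain m where "?r = 2 * m" by (rule evenE)
    then show "F \<in> (\<Union>m\<in>{..n}. homs_with n d (2 * m) (\<lambda>_. True))"
      using F le by (auto simp: homs_with_def intro!: bexI[of _ m])
  qed
  then have "card (periodic_homs n d) \<le> card (\<Union>m\<in>{..n}. homs_with n d (2 * m) (\<lambda>_. True))"
    by (rule card_mono[rotated]) (use finite_periodic_homs[OF assms(2)] in \<open>auto simp: homs_with_def\<close>)
  also have "\<dots> \<le> (\<Sum>m\<le>n. card (homs_with n d (2 * m) (\<lambda>_. True)))" by (rule card_UN_le) simp
  finally have "real (card (periodic_homs n d)) \<le> (\<Sum>m\<le>n. real (card (homs_with n d (2 * m) (\<lambda>_. True))))"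
    by (metis of_nat_le_iff of_nat_sum)
  also have "\<dots> \<le> (\<Sum>m\<le>n. 2 * 2 ^ h * (weight n d ^ m / (fact m)\<^sup>2))"
  proof (rule sum_mono)
    fix m
    show "real (card (homs_with n d (2 * m) (\<lambda>_. True))) \<le> 2 * 2 ^ h * (weight n d ^ m / (fact m)\<^sup>2)"
    proof (cases "m = 0")
      case True
      have "real (card (homs_with n d 0 (\<lambda>_. True))) \<le> real (2 * 2 ^ h)"
        using homs_without_switch(1)[OF assms(2,3), of "\<lambda>_. True"] of_nat_le_iff by blast
      then show ?thesis using True by simp
    next
      case False
      then show ?thesis using card_homs_with_upper[of m d n h] assms by simp
    qed
  qed
  finally show ?thesis by (simp add: sum_distrib_left)
qed

section \<open>Convergence in law\<close>

text \<open>Summing the lower bounds over finite parts of \<open>A\<close> controls the lower limit.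
  The same argument for the complement controls the upper limit, because all laws have total mass
  one.\<close>

lemma pmf_limit_from_below:
  fixes p :: "nat \<Rightarrow> 'a :: countable pmf" and q :: "'a pmf"
  assumes "\<And>z. \<exists>a. a \<longlonglongrightarrow> pmf q z \<and> (\<forall>\<^sub>F j in sequentially. a j \<le> pmf (p j) z)"
  shows "(\<lambda>j. measure (p j) A) \<longlonglongrightarrow> measure q A"
proof -
  have lower: "\<forall>\<^sub>F j in sequentially. c < measure (p j) A" if c: "c < measure q A" for c A
  proof -
    define K where "K i = A \<inter> {z. to_nat z < i}" for i
    have fin: "finite (K i)" for i
      by (rule finite_subset[OF _ finite_vimageI[OF finite_lessThan[of i] inj_to_nat]])
        (auto simp: K_def)
    have "(\<lambda>i. measure q (K i)) \<longlonglongrightarrow> measure q (\<Union>i. K i)"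
      by (rule measure_pmf.finite_Lim_measure_incseq) (auto simp: K_def incseq_def)
    moreover have "(\<Union>i. K i) = A" by (auto simp: K_def)
    ultimately have "\<forall>\<^sub>F i in sequentially. c < measure q (K i)" using c by (metis order_tendstoD(1))
    then obtain i where i: "c < measure q (K i)" using eventually_happens by force
    obtain a where a: "\<And>z. a z \<longlonglongrightarrow> pmf q z" "\<And>z. \<forall>\<^sub>F j in sequentially. a z j \<le> pmf (p j) z"
      using assms by metis
    have "(\<lambda>j. \<Sum>z\<in>K i. a z j) \<longlonglongrightarrow> (\<Sum>z\<in>K i. pmf q z)"
      by (rule tendsto_sum) (rule a)
    moreover have "c < (\<Sum>z\<in>K i. pmf q z)" using i by (simp add: measure_measure_pmf_finite fin)
    ultimately have "\<forall>\<^sub>F j in sequentially. c < (\<Sum>z\<in>K i. a z j)" by (metis order_tendstoD(1))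
    moreover have "\<forall>\<^sub>F j in sequentially. \<forall>z\<in>K i. a z j \<le> pmf (p j) z"
      using a(2) fin by (simp add: eventually_ball_finite)
    ultimately show ?thesis
    proof eventually_elim
      case (elim j)
      then have "c < (\<Sum>z\<in>K i. pmf (p j) z)" by (meson less_le_trans sum_mono)
      also have "\<dots> = measure (p j) (K i)" by (simp add: measure_measure_pmf_finite fin)
      also have "\<dots> \<le> measure (p j) A" by (rule measure_pmf.finite_measure_mono) (auto simp: K_def)
      finally show ?case .
    qed
  qed
  show ?thesis
  proof (rule order_tendstoI)
    fix c assume "measure q A < c"
    then have "1 - c < measure q (- A)"
      using measure_pmf.prob_compl[of A q] by (simp add: Compl_eq_Diff_UNIV)
    from lower[OF this] show "\<forall>\<^sub>F j in sequentially. measure (p j) A < c"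
    proof eventually_elim
      case (elim j)
      then show ?case using measure_pmf.prob_compl[of A "p j"] by (simp add: Compl_eq_Diff_UNIV)
    qed
  qed (rule lower)
qed

text \<open>The modified Bessel function \<open>I\<^sub>0(2 \<surd>y)\<close>.\<close>

definition bessel :: "real \<Rightarrow> real" where
  "bessel y = (\<Sum>m. y ^ m / (fact m)\<^sup>2)"

lemma summable_bessel: "summable (\<lambda>m. y ^ m / (fact m :: real)\<^sup>2)"
proof (rule summable_comparison_test')
  show "summable (\<lambda>m. inverse (fact m) * \<bar>y\<bar> ^ m)" by (rule summable_exp)
  fix m :: nat
  have "(1::real) \<le> fact m" by simp
  then have "\<bar>y\<bar> ^ m / (fact m)\<^sup>2 \<le> \<bar>y\<bar> ^ m / fact m"
    by (intro divide_left_mono) (auto simp: power2_eq_square)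
  moreover have "norm (y ^ m / (fact m)\<^sup>2) = \<bar>y\<bar> ^ m / (fact m)\<^sup>2" by (simp add: power_abs)
  ultimately show "norm (y ^ m / (fact m)\<^sup>2) \<le> inverse (fact m) * \<bar>y\<bar> ^ m"
    by (metis divide_inverse mult.commute)
qed

lemma isCont_bessel: "isCont bessel y"
proof -
  have "isCont (\<lambda>y. \<Sum>m. (1 / (fact m :: real)\<^sup>2) * y ^ m) y"
    by (rule isCont_powser_converges_everywhere) (use summable_bessel in simp)
  then show ?thesis by (simp add: bessel_def[abs_def])
qed

lemma sum_le_bessel:
  assumes "y \<ge> 0"
  shows "(\<Sum>m\<le>k. y ^ m / (fact m :: real)\<^sup>2) \<le> bessel y"
  unfolding bessel_def using assms by (intro sum_le_suminf summable_bessel) auto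

lemma bessel_pos: "y \<ge> 0 \<Longrightarrow> bessel y \<ge> 1"
  using sum_le_bessel[of y 0] by simp

lemma sums_pmf_nat: "pmf p sums 1" for p :: "nat pmf"
proof -
  have "(\<lambda>i. measure p {i}) sums measure p (\<Union>i. {i})"
    by (rule measure_pmf.finite_measure_UNION) (auto simp: disjoint_family_on_def)
  then show ?thesis by (simp add: measure_pmf_single)
qed

text \<open>The probability of the diagonal is not evaluated directly: it is absorbed into a
  constant \<open>c\<close>, which the total mass one then determines.\<close>

lemma pmf_nu:
  assumes "l > 0"
  shows "pmf (nu l) m = (l\<^sup>2) ^ m / (fact m)\<^sup>2 / bessel (l\<^sup>2)"
proof -
  let ?p = "pair_pmf (poisson_pmf l) (poisson_pmf l)"
  let ?D = "{(x, y). x = (y :: nat)}"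
  define c where "c = exp (- l) ^ 2 / measure ?p ?D"
  note ne = set_pmf_nu_cond_nonempty[OF assms]
  have pmf: "pmf (nu l) m = c * ((l\<^sup>2) ^ m / (fact m)\<^sup>2)" for m
  proof -
    let ?q = "cond_pmf ?p ?D"
    have "pmf (nu l) m = measure ?q (fst -` {m})" by (simp add: nu_def pmf_map)
    also have "\<dots> = measure ?q ((fst -` {m}) \<inter> set_pmf ?q)" by (simp add: measure_Int_set_pmf)
    also have "(fst -` {m}) \<inter> set_pmf ?q = {(m, m)}"
      using ne assms by (auto simp: set_cond_pmf set_pair_pmf)
    also have "measure ?q {(m, m)} = pmf ?q (m, m)" by (rule measure_pmf_single)
    also have "\<dots> = c * ((l\<^sup>2) ^ m / (fact m)\<^sup>2)"
      using assms by (simp add: pmf_cond[OF ne] pmf_pair c_def power2_eq_square power_mult_distrib mult_ac)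
    finally show ?thesis .
  qed
  have "(\<lambda>m. (l\<^sup>2) ^ m / (fact m)\<^sup>2) sums bessel (l\<^sup>2)"
    unfolding bessel_def by (rule summable_sums[OF summable_bessel])
  then have "(\<lambda>m. c * ((l\<^sup>2) ^ m / (fact m)\<^sup>2)) sums (c * bessel (l\<^sup>2))" by (rule sums_mult)
  moreover have "(\<lambda>m. c * ((l\<^sup>2) ^ m / (fact m)\<^sup>2)) sums 1"
    using sums_pmf_nat[of "nu l"] by (simp add: pmf[abs_def])
  ultimately have "c * bessel (l\<^sup>2) = 1" by (rule sums_unique2)
  then have "c = 1 / bessel (l\<^sup>2)" using bessel_pos[of "l\<^sup>2"] by (simp add: eq_divide_eq)
  then show ?thesis by (simp add: pmf)
qed

section \<open>Bridges as uniform closed walks, and the limit law\<close>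

lemma cond_pmf_of_set_eq:
  assumes "finite A" "A \<inter> S \<noteq> {}"
  shows "cond_pmf (pmf_of_set A) S = pmf_of_set (A \<inter> S)"
proof (rule pmf_eqI)
  fix x
  have ne: "A \<noteq> {}" using assms by auto
  then have ne2: "set_pmf (pmf_of_set A) \<inter> S \<noteq> {}" using assms by simp
  have "card (A \<inter> S) > 0" "card A > 0" using assms by (auto simp: card_gt_0_iff)
  then show "pmf (cond_pmf (pmf_of_set A) S) x = pmf (pmf_of_set (A \<inter> S)) x"
    using assms ne by (simp add: pmf_cond[OF ne2] measure_pmf_of_set pmf_of_set indicator_def)
qed

text \<open>Conditioning the uniform law on step sequences leaves the uniform law on those with sum
  zero, and the positions of the bridge are their partial sums.\<close>

lemma bridge_range_closed_walks:
  assumes "even k"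
  shows "map_pmf (\<lambda>B. card (B ` {0..k})) (bridge k) =
    map_pmf (\<lambda>ts. card (partial_sums ts)) (pmf_of_set (closed_walks k))"
proof -
  let ?\<phi> = "\<lambda>s i. \<Sum>j<i. s j :: int"
  let ?l = "\<lambda>s. map s [0..<k] :: int list"
  define Pi where "Pi = PiE_dflt {..<k} 0 (\<lambda>_. {-1, 1 :: int})"
  define A where "A = Pi \<inter> ?\<phi> -` {w. w k = 0}"
  have finPi: "finite Pi" unfolding Pi_def by (rule finite_PiE_dflt) auto
  have srw: "simple_random_walk k = map_pmf ?\<phi> (pmf_of_set Pi)"
    unfolding simple_random_walk_def Pi_def by (subst Pi_pmf_of_set) auto
  have nePi: "Pi \<noteq> {}"
  proof -
    have "(\<lambda>i. if i < k then 1 else 0) \<in> Pi" by (auto simp: Pi_def PiE_dflt_def)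
    then show ?thesis by auto
  qed
  have ne: "set_pmf (pmf_of_set Pi) \<inter> ?\<phi> -` {w. w k = 0} \<noteq> {}"
    using set_pmf_bridge_cond_nonempty[OF assms] unfolding srw by auto
  then have "A \<noteq> {}" using finPi nePi by (simp add: A_def)
  have fin: "finite A" using finPi by (simp add: A_def)
  have br: "bridge k = map_pmf ?\<phi> (pmf_of_set A)"
    unfolding bridge_def srw cond_map_pmf[OF ne] A_def
    using cond_pmf_of_set_eq[OF finPi] \<open>A \<noteq> {}\<close> by (simp add: A_def)
  have "bij_betw ?l A (closed_walks k)"
  proof (rule bij_betw_byWitness[where f' = "\<lambda>ts i. if i < k then ts ! i else 0"])
    show "\<forall>s\<in>A. (\<lambda>i. if i < k then ?l s ! i else 0) = s"
      by (auto simp: A_def Pi_def PiE_dflt_def)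
    show "\<forall>ts\<in>closed_walks k. ?l (\<lambda>i. if i < k then ts ! i else 0) = ts"
      by (auto simp: closed_walks_def intro!: nth_equalityI)
    show "?l ` A \<subseteq> closed_walks k"
      by (auto simp: A_def Pi_def PiE_dflt_def closed_walks_def interv_sum_list_conv_sum_set_nat
          atLeast0LessThan)
    show "(\<lambda>ts i. if i < k then ts ! i else 0) ` closed_walks k \<subseteq> A"
    proof
      fix s assume "s \<in> (\<lambda>ts i. if i < k then ts ! i else 0) ` closed_walks k"
      then obtain ts where ts: "ts \<in> closed_walks k" "s = (\<lambda>i. if i < k then ts ! i else 0)" by auto
      have "ts ! i \<in> {1, -1}" if "i < k" for i
      proof -
        have "set ts \<subseteq> {1, -1}" "i < length ts" using ts that by (auto simp: closed_walks_def)
        then show ?thesis using nth_mem by blast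
      qed
      moreover have "(\<Sum>j<k. s j) = sum_list ts"
        using ts by (simp add: sum_list_sum_nth closed_walks_def atLeast0LessThan)
      ultimately show "s \<in> A" using ts by (auto simp: A_def Pi_def PiE_dflt_def closed_walks_def)
    qed
  qed
  then have cw: "pmf_of_set (closed_walks k) = map_pmf ?l (pmf_of_set A)"
    by (rule map_pmf_of_set_bij_betw[symmetric]) fact+
  have "?\<phi> s ` {0..k} = partial_sums (?l s)" for s
  proof -
    have "sum_list (take i (?l s)) = ?\<phi> s i" if "i \<le> k" for i
      using that by (simp add: take_map interv_sum_list_conv_sum_set_nat atLeast0LessThan)
    then show ?thesis by (auto simp: partial_sums_def image_iff)
  qed
  then show ?thesis by (simp add: br cw map_pmf_comp)
qed

text \<open>The denominator is (2m)! and not the number of walks: it includes the factor 1/(m!)^2 of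
  \<open>nu\<close>, which the (2m choose m) in the uniform law combines with.\<close>

definition walk_fraction :: "nat \<Rightarrow> nat \<Rightarrow> real" where
  "walk_fraction m z =
     real (card {ts\<in>closed_walks (2 * m). card (partial_sums ts) + 2 = z}) / fact (2 * m)"

text \<open>\<open>N\<close> is kept alongside the range size because lower bounds are available for
  each number of switches separately.\<close>

definition limit_law :: "real \<Rightarrow> (nat \<times> nat) pmf" where
  "limit_law l = bind_pmf (nu l) (\<lambda>N. map_pmf (\<lambda>B. (N, card (B ` {0..2 * N}) + 2)) (bridge (2 * N)))"

lemma snd_limit_law: "map_pmf snd (limit_law l) = map_pmf (\<lambda>r. r + 2) (bridge_range_size l)"
  by (simp add: limit_law_def bridge_range_size_def map_bind_pmf map_pmf_comp)

lemma pmf_limit_law: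
  assumes "l > 0"
  shows "pmf (limit_law l) (m, z) = walk_fraction m z * (l\<^sup>2) ^ m / bessel (l\<^sup>2)"
proof -
  let ?K = "\<lambda>N. map_pmf (\<lambda>B. (N, card (B ` {0..2 * N}) + 2)) (bridge (2 * N))"
  let ?A = "{ts\<in>closed_walks (2 * m). card (partial_sums ts) + 2 = z}"
  have ne: "closed_walks (2 * m) \<noteq> {}"
    using card_closed_walks[of m] by (metis card.empty binomial_eq_0_iff le_numeral_extra(4) mult_2 not_less le_add1)
  have "pmf (limit_law l) (m, z) = (\<integral>N. pmf (?K N) (m, z) \<partial>measure_pmf (nu l))"
    by (simp add: limit_law_def pmf_bind)
  also have "\<dots> = (\<Sum>N\<in>{m}. pmf (?K N) (m, z) * pmf (nu l) N)"
  proof (rule integral_measure_pmf_real)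
    fix N assume N: "pmf (?K N) (m, z) \<noteq> 0"
    show "N \<in> {m}"
    proof (rule ccontr)
      assume "N \<notin> {m}"
      then have e: "(\<lambda>B :: nat \<Rightarrow> int. (N, card (B ` {0..2 * N}) + 2)) -` {(m, z)} = {}" by auto
      have "pmf (?K N) (m, z) = 0" unfolding pmf_map e by (rule measure_empty)
      then show False using N by simp
    qed
  qed simp
  also have "\<dots> = pmf (?K m) (m, z) * pmf (nu l) m" by simp
  also have "?K m = map_pmf (\<lambda>r. (m, r + 2)) (map_pmf (\<lambda>B. card (B ` {0..2 * m})) (bridge (2 * m)))"
    by (simp add: map_pmf_comp)
  also have "\<dots> = map_pmf (\<lambda>ts. (m, card (partial_sums ts) + 2)) (pmf_of_set (closed_walks (2 * m)))"
    by (subst bridge_range_closed_walks) (simp_all add: map_pmf_comp)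
  also have "pmf \<dots> (m, z) = real (card ?A) / real ((2 * m) choose m)"
  proof -
    have "closed_walks (2 * m) \<inter> (\<lambda>ts. (m, card (partial_sums ts) + 2)) -` {(m, z)} = ?A" by auto
    then show ?thesis
      by (simp add: pmf_map measure_pmf_of_set[OF ne finite_closed_walks] card_closed_walks)
  qed
  also have "real ((2 * m) choose m) = fact (2 * m) / (fact m)\<^sup>2"
    using binomial_fact[of m "2 * m", where ?'a = real] by (simp add: power2_eq_square)
  finally show ?thesis by (simp add: pmf_nu[OF assms] walk_fraction_def)
qed

definition switches_and_range :: "nat \<Rightarrow> nat \<Rightarrow> (nat \<times> nat) pmf" where
  "switches_and_range n d =
     map_pmf (\<lambda>F. (num_switches n F div 2, card (range F))) (pmf_of_set (periodic_homs n d))"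

text \<open>The relative loss in the lower counts: for \<open>m = 0\<close> it covers the at most
  four missing flat functions, otherwise it is the last factor in
  \<open>card_homs_with_lower\<close>.\<close>

definition correction :: "nat \<Rightarrow> nat \<Rightarrow> nat \<Rightarrow> real" where
  "correction m n d =
     (if m = 0 then 1 - 4 / real n else (1 - real m * (2 * (2 * real d + 3) / real n)) ^ (2 * m - 1))"

text \<open>A lower bound on one class is divided by the upper bound on all homomorphisms; the
  common factor \<open>2 * 2 ^ h\<close> cancels.\<close>

lemma pmf_switches_and_range_ge:
  assumes "d \<ge> 2" "4 * d + 2 \<le> n" "even n" "2 * m * (2 * d + 3) < n"
  shows "walk_fraction m z * weight n d ^ m * correction m n d / bessel (weight n d)
    \<le> pmf (switches_and_range n d) (m, z)"
proof -
  let ?A = "periodic_homs n d" and ?B = "homs_with n d (2 * m) (\<lambda>x. x = z)"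
  let ?L = "walk_fraction m z * weight n d ^ m * correction m n d"
  obtain h where h: "n = 2 * h" using assms(3) by (rule evenE)
  have hpos: "h > 0" using assms h by simp
  have w: "weight n d \<ge> 0" by (simp add: weight_def)
  have L: "2 * 2 ^ h * ?L \<le> real (card ?B)"
  proof (cases "m = 0")
    case True
    have cw: "closed_walks 0 = {[]}" by (auto simp: closed_walks_def)
    have ps: "partial_sums [] = {0}" by (auto simp: partial_sums_def)
    show ?thesis
    proof (cases "z = 3")
      case z: True
      have "{ts \<in> closed_walks 0. card (partial_sums ts) + 2 = 3} = {[]}"
        using cw ps by auto
      then have f: "walk_fraction 0 3 = 1" by (simp add: walk_fraction_def)
      \<comment> \<open>This makes the loss of 4 at most the fraction 4/n of
        \<open>2 * 2 ^ h\<close>.\<close>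
      have "h \<le> 2 ^ h" by simp
      then have "real h \<le> 2 ^ h" by (metis of_nat_le_iff of_nat_power of_nat_numeral)
      then have "4 * real h \<le> 4 * 2 ^ h" by simp
      then have "2 * 2 ^ h * (1 - 4 / real n) \<le> 2 * 2 ^ h - 4"
        using hpos by (simp add: h field_simps)
      also have "2 * 2 ^ h - 4 \<le> real (card (homs_with n d 0 (\<lambda>x. x = 3)))"
      proof -
        have "real (2 * 2 ^ h) \<le> real (card (homs_with n d 0 (\<lambda>x. x = 3)) + 4)"
          using homs_without_switch(2)[OF assms(2) h] of_nat_le_iff by blast
        then show ?thesis by simp
      qed
      finally show ?thesis using True z f by (simp add: correction_def)
    next
      case False
      then have "{ts \<in> closed_walks 0. card (partial_sums ts) + 2 = z} = {}"
        using cw ps by auto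
      then have "walk_fraction 0 z = 0" unfolding walk_fraction_def by (simp only: mult_0_right) simp
      then show ?thesis using True by simp
    qed
  next
    case False
    have "real (m * (2 * d + 3)) / real h = real m * (2 * (2 * real d + 3) / real n)"
      using hpos by (simp add: h field_simps)
    then have eq: "?L = real (card {ts\<in>closed_walks (2 * m). card (partial_sums ts) + 2 = z}) *
        weight n d ^ m / fact (2 * m) * (1 - real (m * (2 * d + 3)) / real h) ^ (2 * m - 1)"
      using False by (simp only: correction_def walk_fraction_def if_False times_divide_eq_left)
    have "m * (2 * d + 3) < h" using assms(4) by (simp add: h mult.assoc)
    then show ?thesis
      unfolding eq using False assms(1) by (intro card_homs_with_lower[OF _ _ assms(2) h]) auto
  qed
  have U: "real (card ?A) \<le> 2 * 2 ^ h * bessel (weight n d)"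
    by (rule order_trans[OF card_periodic_homs_upper[OF assms(1,2) h]])
      (rule mult_left_mono[OF sum_le_bessel[OF w]], simp)
  have fin: "finite ?A" by (rule finite_periodic_homs[OF assms(2)])
  have ne: "?A \<noteq> {}"
    using Hom_T_nonempty[OF assms(3), of d] bij_betw_periodic_homs[OF assms(2)] assms(2)
    by (auto simp: bij_betw_def)
  then have pos: "real (card ?A) > 0" using fin by (simp add: card_gt_0_iff)
  have bp: "bessel (weight n d) > 0" using bessel_pos[OF w] by linarith
  have "?L / bessel (weight n d) = 2 * 2 ^ h * ?L / (2 * 2 ^ h * bessel (weight n d))" by simp
  also have "\<dots> \<le> real (card ?B) / (2 * 2 ^ h * bessel (weight n d))"
    using L bp by (intro divide_right_mono) auto
  also have "\<dots> \<le> real (card ?B) / real (card ?A)"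
    using U pos bp by (intro divide_left_mono) auto
  also have "\<dots> \<le> pmf (switches_and_range n d) (m, z)"
  proof -
    have "?B \<subseteq> ?A \<inter> (\<lambda>F. (num_switches n F div 2, card (range F))) -` {(m, z)}"
      by (auto simp: homs_with_def)
    then have "card ?B \<le> card (?A \<inter> (\<lambda>F. (num_switches n F div 2, card (range F))) -` {(m, z)})"
      using fin by (intro card_mono) auto
    then show ?thesis
      unfolding switches_and_range_def pmf_map measure_pmf_of_set[OF ne fin]
      by (intro divide_right_mono) auto
  qed
  finally show ?thesis .
qed

lemma snd_switches_and_range:
  assumes "4 * d + 2 \<le> n" "even n"
  shows "map_pmf (\<lambda>f. card (f ` {0..<n})) (pmf_of_set (Hom_T n d)) =
    map_pmf snd (switches_and_range n d)"
proof -
  let ?r = "\<lambda>F. restrict (\<lambda>i. F (int i)) {0..<n} :: nat \<Rightarrow> int"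
  have n: "n > 0" using assms by simp
  have bij: "bij_betw ?r (periodic_homs n d) (Hom_T n d)" by (rule bij_betw_periodic_homs[OF assms(1)])
  then have ne: "periodic_homs n d \<noteq> {}"
    using Hom_T_nonempty[OF assms(2) n, of d] by (auto simp: bij_betw_def)
  have fin: "finite (periodic_homs n d)" by (rule finite_periodic_homs[OF assms(1)])
  have "map_pmf (\<lambda>f. card (f ` {0..<n})) (pmf_of_set (Hom_T n d)) =
      map_pmf (\<lambda>F. card (?r F ` {0..<n})) (pmf_of_set (periodic_homs n d))"
    unfolding map_pmf_of_set_bij_betw[OF bij ne fin, symmetric] by (simp only: map_pmf_comp)
  also have "\<dots> = map_pmf (\<lambda>F. card (range F)) (pmf_of_set (periodic_homs n d))"
    using ne fin periodic_hom_restrict(2)[OF _ n] by (intro map_pmf_cong) auto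
  also have "\<dots> = map_pmf snd (switches_and_range n d)"
    by (simp add: switches_and_range_def map_pmf_comp)
  finally show ?thesis .
qed

theorem theorem2p9:
  fixes l :: real and n d :: "nat \<Rightarrow> nat"
  assumes "l > 0"
    and "\<And>j. j \<ge> 1 \<Longrightarrow> even (n j) \<and> n j > 0"
    and "\<And>j. j \<ge> 1 \<Longrightarrow> d j > 0"
    and "filterlim n at_top sequentially"
    and "(\<lambda>j. real (n j) / 2 ^ d j) \<longlonglongrightarrow> l"
  shows "weak_conv_m
    (\<lambda>j. distr (measure_pmf (pmf_of_set (Hom_T (n j) (d j)))) borel
            (\<lambda>f. real (card (f ` {0..<n j}))))
    (distr (measure_pmf (bridge_range_size (l / (4 * sqrt 2)))) borel
            (\<lambda>r. real (r + 2)))"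
proof -
  define l' where "l' = l / (4 * sqrt 2)"
  have l': "l' > 0" using assms(1) by (simp add: l'_def)
  have l'2: "l'\<^sup>2 = l\<^sup>2 / 32" by (simp add: l'_def power_divide power_mult_distrib)
  have nreal: "filterlim (\<lambda>j. real (n j)) at_top sequentially"
    by (rule filterlim_compose[OF filterlim_real_sequentially assms(4)])
  have inv_n: "(\<lambda>j. c / real (n j)) \<longlonglongrightarrow> 0" for c
    by (rule real_tendsto_divide_at_top[OF tendsto_const nreal])
  have ratio: "(\<lambda>j. inverse (real (n j) / 2 ^ d j)) \<longlonglongrightarrow> inverse l"
    using assms(1,5) by (intro tendsto_inverse) auto
  have npos: "\<forall>\<^sub>F j in sequentially. n j > 0"
    using assms(2) by (intro eventually_sequentiallyI[of 1]) auto
  \<comment> \<open>The number \<open>2 ^ d j\<close> is \<open>n j\<close> times a factor with the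
    positive limit 1/l, so \<open>d j\<close> tends to infinity too.\<close>
  have "filterlim (\<lambda>j. inverse (real (n j) / 2 ^ d j) * real (n j)) at_top sequentially"
    by (rule filterlim_tendsto_pos_mult_at_top[OF ratio _ nreal]) (use assms(1) in simp)
  then have pow: "filterlim (\<lambda>j. 2 ^ d j :: real) at_top sequentially"
    by (rule filterlim_mono_eventually[OF _ order_refl order_refl])
      (use npos in \<open>auto elim!: eventually_mono\<close>)
  have dtop: "filterlim d at_top sequentially"
    unfolding filterlim_at_top
  proof
    fix K
    have "\<forall>\<^sub>F j in sequentially. (2::real) ^ K \<le> 2 ^ d j"
      using pow unfolding filterlim_at_top by blast
    then show "\<forall>\<^sub>F j in sequentially. K \<le> d j" by eventually_elim simp
  qed
  \<comment> \<open>Write d/n as d/2^d times 2^d/n: a null sequence times a convergent one.\<close>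
  have dn: "(\<lambda>j. real (d j) / real (n j)) \<longlonglongrightarrow> 0"
  proof -
    have "(\<lambda>k. real k / 2 ^ k) \<longlonglongrightarrow> 0" using lim_n_over_pown[of "2::real"] by simp
    then have "(\<lambda>j. real (d j) / 2 ^ d j) \<longlonglongrightarrow> 0" by (rule filterlim_compose[OF _ dtop])
    from tendsto_mult[OF this ratio]
    have "(\<lambda>j. real (d j) / 2 ^ d j * inverse (real (n j) / 2 ^ d j)) \<longlonglongrightarrow> 0" by simp
    then show ?thesis by simp
  qed
  have dn': "(\<lambda>j. 2 * (2 * real (d j) + 3) / real (n j)) \<longlonglongrightarrow> 0"
  proof -
    have "(\<lambda>j. 4 * (real (d j) / real (n j)) + 6 / real (n j)) \<longlonglongrightarrow> 4 * 0 + 0"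
      by (intro tendsto_intros dn inv_n)
    then show ?thesis by (simp add: add_divide_distrib)
  qed
  have small: "\<forall>\<^sub>F j in sequentially. c * (2 * d j + 3) < n j" for c :: nat
  proof -
    have "\<forall>\<^sub>F j in sequentially. real c * (2 * (2 * real (d j) + 3) / real (n j)) < 1"
      using tendsto_mult[OF tendsto_const[of "real c"] dn'] by (simp add: order_tendstoD(2))
    with npos show ?thesis
    proof eventually_elim
      case (elim j)
      then have "real (2 * (c * (2 * d j + 3))) < real (n j)" by (simp add: field_simps)
      then show ?case by linarith
    qed
  qed
  have ev: "\<forall>\<^sub>F j in sequentially. even (n j)"
    using assms(2) by (intro eventually_sequentiallyI[of 1]) auto
  have big: "\<forall>\<^sub>F j in sequentially. 4 * d j + 2 \<le> n j"
    using small[of 2] by eventually_elim simp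
  have wl: "(\<lambda>j. weight (n j) (d j)) \<longlonglongrightarrow> l'\<^sup>2"
    unfolding weight_def l'2 by (intro tendsto_intros assms(5)) simp
  have bl: "(\<lambda>j. bessel (weight (n j) (d j))) \<longlonglongrightarrow> bessel (l'\<^sup>2)"
    by (rule isCont_tendsto_compose[OF isCont_bessel wl])
  have cl: "(\<lambda>j. correction m (n j) (d j)) \<longlonglongrightarrow> 1" for m
  proof (cases "m = 0")
    case True
    have "(\<lambda>j. 1 - 4 / real (n j)) \<longlonglongrightarrow> 1 - 0" by (intro tendsto_intros inv_n)
    then show ?thesis using True by (simp add: correction_def)
  next
    case False
    have "(\<lambda>j. (1 - real m * (2 * (2 * real (d j) + 3) / real (n j))) ^ (2 * m - 1))
        \<longlonglongrightarrow> (1 - real m * 0) ^ (2 * m - 1)"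
      by (intro tendsto_intros dn')
    then show ?thesis using False by (simp add: correction_def)
  qed
  \<comment> \<open>The pair converges first, since its atoms have explicit lower bounds; the range
    size is obtained by projection.\<close>
  have "(\<lambda>j. measure (switches_and_range (n j) (d j)) A) \<longlonglongrightarrow> measure (limit_law l') A" for A
  proof (rule pmf_limit_from_below)
    fix mz :: "nat \<times> nat"
    obtain m z where mz: "mz = (m, z)" by (cases mz)
    let ?a = "\<lambda>j. walk_fraction m z * weight (n j) (d j) ^ m * correction m (n j) (d j)
      / bessel (weight (n j) (d j))"
    have "?a \<longlonglongrightarrow> walk_fraction m z * (l'\<^sup>2) ^ m * 1 / bessel (l'\<^sup>2)"
      by (intro tendsto_intros wl bl cl) (use bessel_pos[of "l'\<^sup>2"] in auto)
    then have "?a \<longlonglongrightarrow> pmf (limit_law l') mz" by (simp add: mz pmf_limit_law[OF l'])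
    moreover have "\<forall>\<^sub>F j in sequentially. ?a j \<le> pmf (switches_and_range (n j) (d j)) mz"
      using ev big small[of "2 * m"] filterlim_at_top[THEN iffD1, OF dtop, rule_format, of 2]
      unfolding mz by eventually_elim (rule pmf_switches_and_range_ge)
    ultimately show "\<exists>a. a \<longlonglongrightarrow> pmf (limit_law l') mz \<and>
        (\<forall>\<^sub>F j in sequentially. a j \<le> pmf (switches_and_range (n j) (d j)) mz)"
      by blast
  qed
  note lim = this
  have cdf_eq: "cdf (distr (measure_pmf p) borel (\<lambda>x. real (f x))) t = measure (map_pmf f p) {y. real y \<le> t}"
    for p :: "'z pmf" and f t
    unfolding cdf_def by (subst measure_distr) (auto simp: vimage_def)
  have "(\<lambda>j. cdf (distr (measure_pmf (pmf_of_set (Hom_T (n j) (d j)))) borel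
            (\<lambda>f. real (card (f ` {0..<n j})))) t)
    \<longlonglongrightarrow> cdf (distr (measure_pmf (bridge_range_size l')) borel (\<lambda>r. real (r + 2))) t" for t
  proof -
    have "(\<lambda>j. measure (map_pmf snd (switches_and_range (n j) (d j))) {y. real y \<le> t})
        \<longlonglongrightarrow> measure (map_pmf snd (limit_law l')) {y. real y \<le> t}"
      using lim by simp
    then have "(\<lambda>j. measure (map_pmf snd (switches_and_range (n j) (d j))) {y. real y \<le> t})
        \<longlonglongrightarrow> cdf (distr (measure_pmf (bridge_range_size l')) borel (\<lambda>r. real (r + 2))) t"
      unfolding cdf_eq snd_limit_law .
    then show ?thesis
    proof (rule Lim_transform_eventually)
      \<comment> \<open>Passing from periodic functions back to \<open>Hom_T\<close> needs
        \<open>n j\<close> even and \<open>4 * d j + 2 <= n j\<close>, which hold for all large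
        \<open>j\<close>.\<close>
      show "\<forall>\<^sub>F j in sequentially. measure (map_pmf snd (switches_and_range (n j) (d j))) {y. real y \<le> t} =
        cdf (distr (measure_pmf (pmf_of_set (Hom_T (n j) (d j)))) borel
            (\<lambda>f. real (card (f ` {0..<n j})))) t"
        using ev big
      proof eventually_elim
        case (elim j)
        show ?case unfolding cdf_eq snd_switches_and_range[OF elim(2,1)] ..
      qed
    qed
  qed
  then show ?thesis by (simp add: weak_conv_m_def weak_conv_def l'_def)
qed

end
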